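(* Let $n\ge 1$, let $A$ be an MR-subalgebra of $\mathcal L_n$ with type $\langle t_i\mid 1\le i\le n\rangle$, and put $r=\sum_{i=1}^n i\,t_i$ and $k=\sum_{i=1}^n t_i$. Then the group $\mathrm{Stab}(A)=\{\varphi\in\mathrm{Aut}(\mathcal L_n)\mid \varphi[A]=A\}$ has order $$|\mathrm{Stab}(A)|=2^{\,n+k-r}\,(n-r)!\,\prod_{i=1}^{n}(i!)^{t_i}\,t_i!.$$
   Context: $\mathcal L_n$ is the face poset of the $n$-cube, represented as the set of signed subsets of $\{1,\dots,n\}$: pairs $(X_1,X_2)$ with $X_1,X_2\subseteq\{1,\dots,n\}$, $X_1\cap X_2=\emptyset$, ordered by $(X_1,X_2)\le(Y_1,Y_2)$ iff $Y_1\subseteq X_1$ and $Y_2\subseteq X_2$. It has maximum $\mathbf 1=(\emptyset,\emptyset)$ and joins (componentwise intersection). For $y=(Y_1,Y_2)\le x=(X_1,X_2)$ put $\Delta(x,y)=(X_1\cup(Y_2\setminus X_2),\,X_2\cup(Y_1\setminus X_1))$ (reflection of $y$ through the centre of $x$). The caret operation $x\mathbin{\hat{}}y=x\wedge\Delta(x\vee y,y)$ is always defined. An MR-subalgebra of $\mathcal L_n$ is a subset containing $\mathbf 1$ and closed under $\vee$, under $\Delta(x,y)$ for $y\le x$, and under caret. $\mathrm{Aut}(\mathcal L_n)$ is the group of bijections of $\mathcal L_n$ preserving $\le$ in both directions and $\Delta$. Type: the coatoms of $A$ are the maximal elements of $A\setminus\{\mathbf 1\}$. For a coatom $a$ of $A$,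 $\mathscr C_a$ is the set of coatoms $c$ of $\mathcal L_n$ with $a\le c$. For each $1\le i\le n$ the number of coatoms $a$ of $A$ with $|\mathscr C_a|=i$ is even, and $t_i$ is defined by $2t_i=|\{a \text{ a coatom of }A: |\mathscr C_a|=i\}|$. The type of $A$ is $\langle t_i\mid 1\le i\le n\rangle$. *)

theory Defs
  imports "HOL-Algebra.Bij" "HOL-Algebra.Coset" "HOL-Algebra.Lattice"
begin

section \<open>The face poset of the cube\<close>

definition cube :: "nat \<Rightarrow> (nat set \<times> nat set) gorder" where
  "cube n =
    \<lparr>carrier = {(X1, X2). X1 \<subseteq> {1..n} \<and> X2 \<subseteq> {1..n} \<and> X1 \<inter> X2 = {}},
     eq = (=),
     le = \<lambda>(X1, X2) (Y1, Y2). Y1 \<subseteq> X1 \<and> Y2 \<subseteq> X2\<rparr>"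

definition cube_top :: "nat set \<times> nat set" where
  "cube_top = ({}, {})"

text \<open>\<open>reflect x y\<close> is meaningful only for \<open>y \<le> x\<close>; it is used only there.\<close>

definition reflect :: "nat set \<times> nat set \<Rightarrow> nat set \<times> nat set \<Rightarrow> nat set \<times> nat set" where
  "reflect x y = (case x of (X1, X2) \<Rightarrow> case y of (Y1, Y2) \<Rightarrow>
     (X1 \<union> (Y2 - X2), X2 \<union> (Y1 - X1)))"

definition caret :: "nat \<Rightarrow> nat set \<times> nat set \<Rightarrow> nat set \<times> nat set \<Rightarrow> nat set \<times> nat set" where
  "caret n x y = x \<sqinter>\<^bsub>cube n\<^esub> reflect (x \<squnion>\<^bsub>cube n\<^esub> y) y"

definition MR_subalgebra :: "nat \<Rightarrow> (nat set \<times> nat set) set \<Rightarrow> bool" where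
  "MR_subalgebra n A \<longleftrightarrow>
     A \<subseteq> carrier (cube n) \<and>
     cube_top \<in> A \<and>
     (\<forall>x\<in>A. \<forall>y\<in>A. x \<squnion>\<^bsub>cube n\<^esub> y \<in> A) \<and>
     (\<forall>x\<in>A. \<forall>y\<in>A. y \<sqsubseteq>\<^bsub>cube n\<^esub> x \<longrightarrow> reflect x y \<in> A) \<and>
     (\<forall>x\<in>A. \<forall>y\<in>A. caret n x y \<in> A)"


section \<open>Automorphisms and stabilizers\<close>

text \<open>As in \<^const>\<open>BijGroup\<close>, bijections of the carrier are represented by
  extensional functions, so that each bijection is counted exactly once.\<close>

definition cube_auto :: "nat \<Rightarrow> (nat set \<times> nat set \<Rightarrow> nat set \<times> nat set) set" where
  "cube_auto n = {\<phi> \<in> Bij (carrier (cube n)).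
     (\<forall>x\<in>carrier (cube n). \<forall>y\<in>carrier (cube n).
        \<phi> x \<sqsubseteq>\<^bsub>cube n\<^esub> \<phi> y \<longleftrightarrow> x \<sqsubseteq>\<^bsub>cube n\<^esub> y) \<and>
     (\<forall>x\<in>carrier (cube n). \<forall>y\<in>carrier (cube n).
        y \<sqsubseteq>\<^bsub>cube n\<^esub> x \<longrightarrow> \<phi> (reflect x y) = reflect (\<phi> x) (\<phi> y))}"

definition Aut :: "nat \<Rightarrow> (nat set \<times> nat set \<Rightarrow> nat set \<times> nat set) monoid" where
  "Aut n = BijGroup (carrier (cube n)) \<lparr>carrier := cube_auto n\<rparr>"

definition Stab ::
  "nat \<Rightarrow> (nat set \<times> nat set) set \<Rightarrow> (nat set \<times> nat set \<Rightarrow> nat set \<times> nat set) monoid" where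
  "Stab n A = (Aut n) \<lparr>carrier := {\<phi> \<in> carrier (Aut n). \<phi> ` A = A}\<rparr>"


section \<open>Type of a subalgebra\<close>

definition coatoms :: "nat \<Rightarrow> (nat set \<times> nat set) set \<Rightarrow> (nat set \<times> nat set) set" where
  "coatoms n A = {a \<in> A - {cube_top}. \<forall>b \<in> A - {cube_top}. a \<sqsubseteq>\<^bsub>cube n\<^esub> b \<longrightarrow> b = a}"

definition coatoms_above :: "nat \<Rightarrow> nat set \<times> nat set \<Rightarrow> (nat set \<times> nat set) set" where
  "coatoms_above n a = {c \<in> coatoms n (carrier (cube n)). a \<sqsubseteq>\<^bsub>cube n\<^esub> c}"

text \<open>\<open>has_type n A t\<close> says that \<open>A\<close> has type \<open>\<langle>t i | 1 \<le> i \<le> n\<rangle>\<close>; values of \<open>t\<close> outside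
  \<open>{1..n}\<close> are irrelevant. Lemma \<open>ex_has_type\<close> shows that every subalgebra has a type.\<close>

definition has_type :: "nat \<Rightarrow> (nat set \<times> nat set) set \<Rightarrow> (nat \<Rightarrow> nat) \<Rightarrow> bool" where
  "has_type n A t \<longleftrightarrow>
     (\<forall>i\<in>{1..n}. 2 * t i = card {a \<in> coatoms n A. card (coatoms_above n a) = i})"


section \<open>Basic facts\<close>

lemma cube_carrier [simp]:
  "(X1, X2) \<in> carrier (cube n) \<longleftrightarrow> X1 \<subseteq> {1..n} \<and> X2 \<subseteq> {1..n} \<and> X1 \<inter> X2 = {}"
  by (simp add: cube_def)

lemma cube_le [simp]: "(X1, X2) \<sqsubseteq>\<^bsub>cube n\<^esub> (Y1, Y2) \<longleftrightarrow> Y1 \<subseteq> X1 \<and> Y2 \<subseteq> X2"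
  by (simp add: cube_def)

lemma cube_eq [simp]: "x .=\<^bsub>cube n\<^esub> y \<longleftrightarrow> x = y"
  by (simp add: cube_def)

lemma reflect_Pair [simp]:
  "reflect (X1, X2) (Y1, Y2) = (X1 \<union> (Y2 - X2), X2 \<union> (Y1 - X1))"
  by (simp add: reflect_def)

lemma finite_cube: "finite (carrier (cube n))"
proof (rule finite_subset)
  show "carrier (cube n) \<subseteq> Pow {1..n} \<times> Pow {1..n}" by (auto simp: cube_def)
qed simp

lemma partial_order_cube: "partial_order (cube n)"
proof
  show "(.=\<^bsub>cube n\<^esub>) = (=)" by (simp add: cube_def)
qed (auto simp: cube_def)

lemma top_cube: "\<top>\<^bsub>cube n\<^esub> = cube_top"
proof -
  interpret partial_order "cube n" by (rule partial_order_cube)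
  have g: "greatest (cube n) cube_top (carrier (cube n))"
    by (auto simp: greatest_def cube_top_def)
  show ?thesis unfolding top_def
    using g greatest_unique by (blast intro: some_equality)
qed

lemma join_cube:
  assumes "(X1, X2) \<in> carrier (cube n)" "(Y1, Y2) \<in> carrier (cube n)"
  shows "(X1, X2) \<squnion>\<^bsub>cube n\<^esub> (Y1, Y2) = (X1 \<inter> Y1, X2 \<inter> Y2)"
proof -
  interpret partial_order "cube n" by (rule partial_order_cube)
  have l: "least (cube n) (X1 \<inter> Y1, X2 \<inter> Y2) (Upper (cube n) {(X1, X2), (Y1, Y2)})"
    using assms by (auto simp: least_def Upper_def)
  show ?thesis unfolding join_def sup_def
    using l least_unique by (blast intro: some_equality)
qed

lemma meet_cube:
  assumes "(X1, X2) \<in> carrier (cube n)" "(Y1, Y2) \<in> carrier (cube n)"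
    and "(X1 \<union> Y1) \<inter> (X2 \<union> Y2) = {}"
  shows "(X1, X2) \<sqinter>\<^bsub>cube n\<^esub> (Y1, Y2) = (X1 \<union> Y1, X2 \<union> Y2)"
proof -
  interpret partial_order "cube n" by (rule partial_order_cube)
  have l: "greatest (cube n) (X1 \<union> Y1, X2 \<union> Y2) (Lower (cube n) {(X1, X2), (Y1, Y2)})"
    using assms by (auto simp: greatest_def Lower_def)
  show ?thesis unfolding meet_def inf_def
    using l greatest_unique by (blast intro: some_equality)
qed

text \<open>In particular the meet in the definition of the caret always exists.\<close>

lemma caret_cube:
  assumes x: "(X1, X2) \<in> carrier (cube n)" and y: "(Y1, Y2) \<in> carrier (cube n)"
  shows "caret n (X1, X2) (Y1, Y2) = (X1 \<union> (Y2 - X2), X2 \<union> (Y1 - X1))"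
proof -
  have r: "reflect ((X1, X2) \<squnion>\<^bsub>cube n\<^esub> (Y1, Y2)) (Y1, Y2) =
      (X1 \<inter> Y1 \<union> (Y2 - X2), X2 \<inter> Y2 \<union> (Y1 - X1))"
    unfolding join_cube[OF x y] by auto
  show ?thesis unfolding caret_def r
    by (subst meet_cube) (use x y in auto)
qed

lemma reflect_closed:
  assumes "x \<in> carrier (cube n)" "y \<in> carrier (cube n)" "y \<sqsubseteq>\<^bsub>cube n\<^esub> x"
  shows "reflect x y \<in> carrier (cube n)" "reflect x y \<sqsubseteq>\<^bsub>cube n\<^esub> x"
  using assms by (cases x; cases y; auto)+

lemma cube_autoD:
  assumes "f \<in> cube_auto n" "x \<in> carrier (cube n)" "y \<in> carrier (cube n)"
  shows "f x \<in> carrier (cube n)"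
    and "f x \<sqsubseteq>\<^bsub>cube n\<^esub> f y \<longleftrightarrow> x \<sqsubseteq>\<^bsub>cube n\<^esub> y"
    and "y \<sqsubseteq>\<^bsub>cube n\<^esub> x \<Longrightarrow> f (reflect x y) = reflect (f x) (f y)"
proof -
  have "f \<in> Bij (carrier (cube n))" using assms(1) by (simp add: cube_auto_def)
  from Bij_imp_funcset[OF this] show "f x \<in> carrier (cube n)"
    using assms(2) by (rule funcset_mem)
qed (use assms in \<open>auto simp only: cube_auto_def mem_Collect_eq\<close>)

lemma subgroup_cube_auto: "subgroup (cube_auto n) (BijGroup (carrier (cube n)))"
proof -
  let ?S = "carrier (cube n)"
  interpret G: group "BijGroup ?S" by (rule group_BijGroup)
  show ?thesis
  proof (rule G.subgroupI)
    show "cube_auto n \<subseteq> carrier (BijGroup ?S)" unfolding cube_auto_def BijGroup_def by simp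
    have "(\<lambda>x\<in>?S. x) \<in> cube_auto n"
      unfolding cube_auto_def using id_Bij[of ?S] reflect_closed(1)[of _ n]
      by (simp del: Id_compose compose_Id)
    then show "cube_auto n \<noteq> {}" by blast
  next
    fix f assume f: "f \<in> cube_auto n"
    then have fB: "f \<in> Bij ?S" by (simp add: cube_auto_def)
    then have b: "bij_betw f ?S ?S" by (simp add: Bij_def)
    let ?g = "inv_into ?S f"
    have g: "?g x \<in> ?S" if "x \<in> ?S" for x
      using Bij_inv_into_mem[OF fB that] .
    have fg: "f (?g x) = x" if "x \<in> ?S" for x
      using bij_betw_inv_into_right[OF b that] .
    have gf: "?g (f x) = x" if "x \<in> ?S" for x
      using bij_betw_inv_into_left[OF b that] .
    have le: "?g x \<sqsubseteq>\<^bsub>cube n\<^esub> ?g y \<longleftrightarrow> x \<sqsubseteq>\<^bsub>cube n\<^esub> y" if "x \<in> ?S" "y \<in> ?S" for x y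
      using cube_autoD(2)[OF f g[OF that(1)] g[OF that(2)]] unfolding fg[OF that(1)] fg[OF that(2)] ..
    have re: "?g (reflect x y) = reflect (?g x) (?g y)"
      if xy: "x \<in> ?S" "y \<in> ?S" "y \<sqsubseteq>\<^bsub>cube n\<^esub> x" for x y
    proof -
      have l: "?g y \<sqsubseteq>\<^bsub>cube n\<^esub> ?g x" using le[OF xy(2,1)] xy(3) by (rule iffD2)
      have "f (reflect (?g x) (?g y)) = reflect x y"
        using cube_autoD(3)[OF f g[OF xy(1)] g[OF xy(2)] l] unfolding fg[OF xy(1)] fg[OF xy(2)] .
      moreover have "?g (f (reflect (?g x) (?g y))) = reflect (?g x) (?g y)"
        by (rule gf, rule reflect_closed(1)[OF g[OF xy(1)] g[OF xy(2)] l])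
      ultimately show ?thesis by (simp only:)
    qed
    show "inv\<^bsub>BijGroup ?S\<^esub> f \<in> cube_auto n"
      unfolding inv_BijGroup[OF fB] cube_auto_def
      using restrict_inv_into_Bij[OF fB] le re reflect_closed(1) by simp
  next
    fix f h assume f: "f \<in> cube_auto n" and h: "h \<in> cube_auto n"
    then have B: "f \<in> Bij ?S" "h \<in> Bij ?S" by (simp_all add: cube_auto_def)
    have "compose ?S f h \<in> cube_auto n"
      unfolding cube_auto_def
      using compose_Bij[OF B] reflect_closed(1) cube_autoD[OF f] cube_autoD[OF h]
      by (simp add: compose_eq)
    then show "f \<otimes>\<^bsub>BijGroup ?S\<^esub> h \<in> cube_auto n" using B by (simp add: BijGroup_def)
  qed
qed

lemma group_Aut: "group (Aut n)"
  unfolding Aut_def by (rule subgroup.subgroup_is_group[OF subgroup_cube_auto group_BijGroup])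

lemma subgroup_Stab:
  assumes A: "A \<subseteq> carrier (cube n)"
  shows "subgroup (carrier (Stab n A)) (Aut n)"
proof -
  let ?S = "carrier (cube n)"
  interpret G: group "Aut n" by (rule group_Aut)
  have B: "f \<in> Bij ?S" if "f \<in> carrier (Aut n)" for f
    using that by (simp add: Aut_def cube_auto_def)
  have mult: "f \<otimes>\<^bsub>Aut n\<^esub> h = compose ?S f h"
    if "f \<in> carrier (Aut n)" "h \<in> carrier (Aut n)" for f h
    using B[OF that(1)] B[OF that(2)] by (simp add: Aut_def BijGroup_def)
  have one: "\<one>\<^bsub>Aut n\<^esub> = (\<lambda>x\<in>?S. x)" by (simp add: Aut_def BijGroup_def)
  have im: "compose ?S f h ` A = f ` h ` A" for f h
    using A by (force simp: compose_def)
  show ?thesis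
  proof (rule G.subgroupI)
    show "carrier (Stab n A) \<subseteq> carrier (Aut n)" by (auto simp: Stab_def)
    have "\<one>\<^bsub>Aut n\<^esub> ` A = A" unfolding one using A by force
    then have "\<one>\<^bsub>Aut n\<^esub> \<in> carrier (Stab n A)" by (simp add: Stab_def)
    then show "carrier (Stab n A) \<noteq> {}" by blast
  next
    fix f assume "f \<in> carrier (Stab n A)"
    then have f: "f \<in> carrier (Aut n)" and fA: "f ` A = A" by (auto simp: Stab_def)
    let ?g = "inv\<^bsub>Aut n\<^esub> f"
    have g: "?g \<in> carrier (Aut n)" using f by simp
    have "?g ` A = ?g ` f ` A" by (simp add: fA)
    also have "\<dots> = (?g \<otimes>\<^bsub>Aut n\<^esub> f) ` A" unfolding mult[OF g f] by (rule im[symmetric])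
    also have "\<dots> = A" unfolding G.l_inv[OF f] one using A by force
    finally show "?g \<in> carrier (Stab n A)" using g by (simp add: Stab_def)
  next
    fix f h assume "f \<in> carrier (Stab n A)" "h \<in> carrier (Stab n A)"
    then have f: "f \<in> carrier (Aut n)" "f ` A = A" and h: "h \<in> carrier (Aut n)" "h ` A = A"
      by (auto simp: Stab_def)
    have "(f \<otimes>\<^bsub>Aut n\<^esub> h) ` A = A"
      unfolding mult[OF f(1) h(1)] im by (simp only: f(2) h(2))
    then show "f \<otimes>\<^bsub>Aut n\<^esub> h \<in> carrier (Stab n A)"
      using G.m_closed[OF f(1) h(1)] by (simp add: Stab_def)
  qed
qed

lemma group_Stab: "A \<subseteq> carrier (cube n) \<Longrightarrow> group (Stab n A)"
  using subgroup.subgroup_is_group[OF subgroup_Stab group_Aut] by (simp add: Stab_def)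

lemma coatoms_cube:
  "coatoms n (carrier (cube n)) = (\<lambda>i. ({i}, {})) ` {1..n} \<union> (\<lambda>i. ({}, {i})) ` {1..n}"
  (is "?L = ?R")
proof (intro equalityI subsetI)
  fix c assume c: "c \<in> ?L"
  obtain X1 X2 where [simp]: "c = (X1, X2)" by (cases c)
  have C: "X1 \<subseteq> {1..n}" "X2 \<subseteq> {1..n}" "X1 \<inter> X2 = {}" "X1 \<noteq> {} \<or> X2 \<noteq> {}"
    using c by (auto simp: coatoms_def cube_top_def)
  have m: "b = c" if "b \<in> carrier (cube n)" "b \<noteq> cube_top" "c \<sqsubseteq>\<^bsub>cube n\<^esub> b" for b
    using c that unfolding coatoms_def by blast
  show "c \<in> ?R"
  proof (cases "X1 = {}")
    case False
    then obtain i where i: "i \<in> X1" by blast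
    have "({i}, {}) = c" by (rule m) (use i C in \<open>auto simp: cube_top_def\<close>)
    then show ?thesis using i C by auto
  next
    case True
    then obtain i where i: "i \<in> X2" using C by blast
    have "({}, {i}) = c" by (rule m) (use i C in \<open>auto simp: cube_top_def\<close>)
    then show ?thesis using i C by auto
  qed
qed (auto simp: coatoms_def cube_top_def)

lemma card_coatoms_above:
  assumes "(X1, X2) \<in> carrier (cube n)"
  shows "card (coatoms_above n (X1, X2)) = card (X1 \<union> X2)"
proof -
  have fin: "finite X1" "finite X2" using assms by (auto intro: finite_subset)
  have "coatoms_above n (X1, X2) = (\<lambda>i. ({i}, {})) ` X1 \<union> (\<lambda>i. ({}, {i})) ` X2"
    using assms unfolding coatoms_above_def coatoms_cube by auto
  also have "card \<dots> = card X1 + card X2"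
    using fin by (subst card_Un_disjoint) (auto simp: card_image inj_on_def)
  also have "\<dots> = card (X1 \<union> X2)"
    using fin assms by (subst card_Un_disjoint) auto
  finally show ?thesis .
qed

lemma reflect_cube_top: "reflect cube_top (Y1, Y2) = (Y2, Y1)"
  by (simp add: cube_top_def)

lemma coatoms_carrier:
  assumes "MR_subalgebra n A" "(X1, X2) \<in> coatoms n A"
  shows "X1 \<subseteq> {1..n} \<and> X2 \<subseteq> {1..n} \<and> X1 \<inter> X2 = {} \<and> (X1 \<noteq> {} \<or> X2 \<noteq> {})"
proof -
  have "(X1, X2) \<in> carrier (cube n)" "(X1, X2) \<noteq> cube_top"
    using assms by (auto simp only: MR_subalgebra_def coatoms_def mem_Collect_eq Diff_iff singleton_iff)
  then show ?thesis by (simp add: cube_top_def)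
qed

lemma swap_coatoms:
  assumes A: "MR_subalgebra n A" and a: "(X1, X2) \<in> coatoms n A"
  shows "(X2, X1) \<in> coatoms n A"
proof -
  have sw: "(Y2, Y1) \<in> A" if "(Y1, Y2) \<in> A" for Y1 Y2
  proof -
    have "(Y1, Y2) \<sqsubseteq>\<^bsub>cube n\<^esub> cube_top" by (simp add: cube_top_def)
    then have "reflect cube_top (Y1, Y2) \<in> A"
      using A that unfolding MR_subalgebra_def by blast
    then show ?thesis by (simp add: reflect_cube_top)
  qed
  have m: "(X1, X2) \<in> A" "(X1, X2) \<noteq> cube_top"
    using a unfolding coatoms_def by blast+
  have max: "b = (X1, X2)" if "b \<in> A" "b \<noteq> cube_top" "(X1, X2) \<sqsubseteq>\<^bsub>cube n\<^esub> b" for b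
    using a that unfolding coatoms_def by blast
  have "b = (X2, X1)" if b: "b \<in> A" "b \<noteq> cube_top" "(X2, X1) \<sqsubseteq>\<^bsub>cube n\<^esub> b" for b
  proof -
    obtain Y1 Y2 where [simp]: "b = (Y1, Y2)" by (cases b)
    have "(Y2, Y1) = (X1, X2)"
      by (rule max) (use b sw[of Y1 Y2] in \<open>auto simp: cube_top_def\<close>)
    then show ?thesis by simp
  qed
  then show ?thesis
    using sw[OF m(1)] m(2) unfolding coatoms_def by (auto simp: cube_top_def)
qed

lemma even_card_coatoms:
  assumes A: "MR_subalgebra n A"
  shows "even (card {a \<in> coatoms n A. card (coatoms_above n a) = i})"
proof -
  let ?P = "{a \<in> coatoms n A. card (coatoms_above n a) = i}"
  let ?p = "\<lambda>a :: nat set \<times> nat set. {a, prod.swap a}"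
  have sub: "coatoms n A \<subseteq> carrier (cube n)" using A by (auto simp: MR_subalgebra_def coatoms_def)
  have fin: "finite ?P" using finite_subset[OF sub finite_cube] by simp
  have sw: "prod.swap a \<in> ?P" if "a \<in> ?P" for a
  proof -
    obtain X1 X2 where [simp]: "a = (X1, X2)" by (cases a)
    have c: "(X1, X2) \<in> carrier (cube n)" "(X2, X1) \<in> carrier (cube n)"
      using that coatoms_carrier[OF A, of X1 X2] by auto
    show ?thesis using that swap_coatoms[OF A, of X1 X2] card_coatoms_above[OF c(1)] card_coatoms_above[OF c(2)]
      by (simp add: Un_commute)
  qed
  have ne: "prod.swap a \<noteq> a" if "a \<in> ?P" for a
    using that coatoms_carrier[OF A, of "fst a" "snd a"] by (cases a) auto
  have un: "\<Union> (?p ` ?P) = ?P"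
  proof (intro equalityI subsetI)
    fix x assume "x \<in> \<Union> (?p ` ?P)"
    then obtain a where a: "a \<in> ?P" "x = a \<or> x = prod.swap a" by blast
    from a(2) show "x \<in> ?P"
    proof
      assume "x = a" with a(1) show ?thesis by (simp only:)
    next
      assume "x = prod.swap a" with sw[OF a(1)] show ?thesis by (simp only:)
    qed
  qed blast
  have "2 * card (?p ` ?P) = card (\<Union> (?p ` ?P))"
  proof (rule card_partition)
    show "finite (?p ` ?P)" using fin by simp
    show "finite (\<Union> (?p ` ?P))" unfolding un by (rule fin)
    show "card c = 2" if "c \<in> ?p ` ?P" for c
    proof -
      from that obtain a where a: "a \<in> ?P" "c = ?p a" by blast
      show ?thesis unfolding a(2) using ne[OF a(1)] by (simp add: card_insert_if eq_commute[of a])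
    qed
    show "c \<inter> d = {}" if "c \<in> ?p ` ?P" "d \<in> ?p ` ?P" "c \<noteq> d" for c d
    proof -
      from that obtain a b where ab: "c = ?p a" "d = ?p b" by blast
      show ?thesis using that(3) unfolding ab by (cases a; cases b) auto
    qed
  qed
  then have "card ?P = 2 * card (?p ` ?P)" unfolding un by (rule sym)
  then show ?thesis by (rule dvdI)
qed

lemma ex_has_type: "MR_subalgebra n A \<Longrightarrow> \<exists>t. has_type n A t"
  unfolding has_type_def
  by (rule exI[of _ "\<lambda>i. card {a \<in> coatoms n A. card (coatoms_above n a) = i} div 2"])
     (simp add: even_card_coatoms)

text \<open>The following bound guarantees that natural-number subtraction of
  \<open>\<Sum>i=1..n. i * t i\<close> from \<open>n\<close> does not truncate.\<close>

lemma coatoms_share: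
  assumes A: "MR_subalgebra n A"
    and a: "(X1, X2) \<in> coatoms n A" and b: "(Y1, Y2) \<in> coatoms n A"
    and j: "j \<in> X1 \<inter> Y1 \<or> j \<in> X2 \<inter> Y2"
  shows "(X1, X2) = (Y1, Y2)"
proof -
  have m: "(X1, X2) \<in> A" "(Y1, Y2) \<in> A" using a b by (auto simp: coatoms_def)
  have c: "(X1, X2) \<in> carrier (cube n)" "(Y1, Y2) \<in> carrier (cube n)"
    using coatoms_carrier[OF A a] coatoms_carrier[OF A b] by simp_all
  have "(X1, X2) \<squnion>\<^bsub>cube n\<^esub> (Y1, Y2) \<in> A" using A m unfolding MR_subalgebra_def by blast
  then have "(X1 \<inter> Y1, X2 \<inter> Y2) \<in> A - {cube_top}"
    using j unfolding join_cube[OF c] by (auto simp: cube_top_def)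
  moreover have "(X1, X2) \<sqsubseteq>\<^bsub>cube n\<^esub> (X1 \<inter> Y1, X2 \<inter> Y2)" "(Y1, Y2) \<sqsubseteq>\<^bsub>cube n\<^esub> (X1 \<inter> Y1, X2 \<inter> Y2)"
    by auto
  ultimately have "(X1 \<inter> Y1, X2 \<inter> Y2) = (X1, X2)" "(X1 \<inter> Y1, X2 \<inter> Y2) = (Y1, Y2)"
    using a b unfolding coatoms_def by blast+
  then show ?thesis by simp
qed

lemma type_sum_le:
  assumes A: "MR_subalgebra n A" and t: "has_type n A t"
  shows "(\<Sum>i=1..n. i * t i) \<le> n"
proof -
  let ?C = "coatoms n A"
  have sub: "?C \<subseteq> carrier (cube n)" using A by (auto simp: MR_subalgebra_def coatoms_def)
  have fin: "finite ?C" using finite_subset[OF sub finite_cube] .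
  let ?s = "\<lambda>a :: nat set \<times> nat set. fst a \<union> snd a"
  have s: "?s a \<subseteq> {1..n}" if "a \<in> ?C" for a
    using that coatoms_carrier[OF A, of "fst a" "snd a"] by simp
  have cs: "card (coatoms_above n a) = card (?s a)" if "a \<in> ?C" for a
    using that sub card_coatoms_above[of "fst a" "snd a" n] by auto
  have sn: "card (?s a) \<le> n" if "a \<in> ?C" for a
    using card_mono[OF _ s[OF that]] by simp
  have two: "card {a \<in> ?C. j \<in> ?s a} \<le> 2" for j
  proof (cases "{a \<in> ?C. j \<in> ?s a} = {}")
    case True
    show ?thesis unfolding True by simp
  next
    case False
    then obtain X1 X2 where a: "(X1, X2) \<in> ?C" "j \<in> X1 \<union> X2" by auto
    have a': "(X2, X1) \<in> ?C" by (rule swap_coatoms[OF A a(1)])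
    have "{a \<in> ?C. j \<in> ?s a} \<subseteq> {(X1, X2), (X2, X1)}"
    proof
      fix b assume b: "b \<in> {a \<in> ?C. j \<in> ?s a}"
      obtain Y1 Y2 where [simp]: "b = (Y1, Y2)" by (cases b)
      have "j \<in> X1 \<inter> Y1 \<or> j \<in> X2 \<inter> Y2 \<or> j \<in> X2 \<inter> Y1 \<or> j \<in> X1 \<inter> Y2" using a b by auto
      then show "b \<in> {(X1, X2), (X2, X1)}"
        using coatoms_share[OF A a(1), of Y1 Y2 j] coatoms_share[OF A a', of Y1 Y2 j] b by auto
    qed
    then have "card {a \<in> ?C. j \<in> ?s a} \<le> card {(X1, X2), (X2, X1)}"
      by (rule card_mono[rotated]) simp
    also have "\<dots> \<le> length [(X1, X2), (X2, X1)]" by (rule card_length[of "[(X1, X2), (X2, X1)]", unfolded list.set])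
    finally show ?thesis by simp
  qed
  have "2 * (\<Sum>i=1..n. i * t i) = (\<Sum>i=1..n. i * card {a \<in> ?C. card (?s a) = i})"
    unfolding sum_distrib_left
  proof (rule sum.cong)
    fix i assume "i \<in> {1..n}"
    then have "2 * t i = card {a \<in> ?C. card (coatoms_above n a) = i}"
      using t by (simp add: has_type_def)
    also have "{a \<in> ?C. card (coatoms_above n a) = i} = {a \<in> ?C. card (?s a) = i}"
      using cs by auto
    finally have "i * (2 * t i) = i * card {a \<in> ?C. card (?s a) = i}" by (rule arg_cong)
    then show "2 * (i * t i) = i * card {a \<in> ?C. card (?s a) = i}"
      by (simp only: mult.left_commute)
  qed simp
  also have "\<dots> \<le> (\<Sum>i\<in>{0..n}. i * card {a \<in> ?C. card (?s a) = i})"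
    by (rule sum_mono2) auto
  also have "\<dots> = (\<Sum>i\<in>{0..n}. \<Sum>a\<in>{a \<in> ?C. card (?s a) = i}. card (?s a))"
    by (rule sum.cong) auto
  also have "\<dots> = (\<Sum>a\<in>?C. card (?s a))"
    by (rule sum.group) (use fin sn in auto)
  also have "\<dots> = (\<Sum>a\<in>?C. \<Sum>j\<in>{j \<in> {1..n}. j \<in> ?s a}. 1)"
  proof (rule sum.cong)
    fix a assume "a \<in> ?C"
    then have "{j \<in> {1..n}. j \<in> ?s a} = ?s a" using s by blast
    then show "card (?s a) = (\<Sum>j\<in>{j \<in> {1..n}. j \<in> ?s a}. 1)" by simp
  qed simp
  also have "\<dots> = (\<Sum>j\<in>{1..n}. \<Sum>a\<in>{a \<in> ?C. j \<in> ?s a}. 1)"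
    by (rule sum.swap_restrict) (use fin in auto)
  also have "\<dots> \<le> (\<Sum>j\<in>{1..n}. 2)"
    by (rule sum_mono) (use two in simp)
  finally show ?thesis by simp
qed

end

(* An automorphism of the cube is a signed permutation: it permutes the 2n coatoms (the literals)
   and commutes with negation, and every face is determined by the set of literals above it.
   A subalgebra consists of the consistent unions of its coatoms, and its coatoms come in pairs
   {a, -a} with pairwise disjoint supports. After reorienting the coordinates, the coatoms are B \<times> {True}
   and B \<times> {False} for disjoint blocks B, and a signed permutation, written as a permutation p together
   with a sign function e, stabilizes the subalgebra iff p permutes the blocks and e is constant
   on each block. The pairs (p, e) are counted independently. *)

theory Submission
  imports Defs "HOL-Library.Disjoint_Sets"
begin

text \<open>In the original coordinates a coatom \<open>(X1, X2)\<close> mixes both signs, so the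
  sign changes allowed on a block would depend on the coatom to which it is carried. Declaring one
  coatom of each opposite pair positive removes this coupling: the sign condition no longer mentions
  the permutation, and the count becomes a product. The sign functions have one free bit per block
  and one per coordinate outside all blocks, hence k + (n - r) bits. The permutations are sorted by
  their action on the blocks: the blocks of size i are permuted among themselves in
  \<open>t i\<close> factorial ways, each of them contributes i! for its own points, and the
  uncovered coordinates contribute (n - r)!. That coatoms generate the subalgebra rests on the
  caret: on sets of literals it yields relative differences and consistent unions.\<close>

section \<open>Counting colour-preserving injections and functions constant on fibres\<close>

text \<open>Such an injection is an independent choice of a bijection between the two fibres over
  each colour. It is used twice: for blocks coloured by their size, and for points coloured by their
  block. \<open>K\<close> may contain colours that do not occur; they contribute 0! = 1.\<close>

lemma card_coloured_bijections:
  assumes "finite A" "finite B" "finite K" "c ` A \<subseteq> K"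
    and "\<And>k. k \<in> K \<Longrightarrow> card {x \<in> A. c x = k} = card {y \<in> B. d y = k}"
  shows "card {f \<in> A \<rightarrow>\<^sub>E B. inj_on f A \<and> (\<forall>x\<in>A. d (f x) = c x)} =
    (\<Prod>k\<in>K. fact (card {x \<in> A. c x = k}))"
  using assms
proof (induction A arbitrary: B rule: finite_induct)
  case empty
  have "{f \<in> {} \<rightarrow>\<^sub>E B. inj_on f {} \<and> (\<forall>x\<in>{}. d (f x) = c x)} = {\<lambda>_. undefined}" by auto
  then show ?case by simp
next
  case (insert a A)
  let ?F = "\<lambda>A B. {f \<in> A \<rightarrow>\<^sub>E B. inj_on f A \<and> (\<forall>x\<in>A. d (f x) = c x)}"
  let ?B = "{b \<in> B. d b = c a}"
  let ?m = "card {x \<in> A. c x = c a}"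
  have ins: "card {x \<in> insert a A. c x = k} = card {x \<in> A. c x = k} + (if c a = k then 1 else 0)" for k
  proof -
    have "{x \<in> insert a A. c x = k} = (if c a = k then insert a {x \<in> A. c x = k} else {x \<in> A. c x = k})"
      by auto
    then show ?thesis using insert.hyps by simp
  qed
  \<comment> \<open>The new point \<open>a\<close> enlarges only the fibre of its own colour, so it
    has one more possible image than that fibre had points before.\<close>
  have cB: "card ?B = Suc ?m"
    using insert.prems(4)[of "c a"] insert.prems(3) unfolding ins by simp
  have IH: "card (?F A (B - {b})) = (\<Prod>k\<in>K. fact (card {x \<in> A. c x = k}))" if "b \<in> ?B" for b
  proof (rule insert.IH[of "B - {b}"])
    show "finite (B - {b})" "finite K" "c ` A \<subseteq> K" using insert.prems(1-3) by simp_all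
    fix k assume k: "k \<in> K"
    have "{y \<in> B - {b}. d y = k} = {y \<in> B. d y = k} - {b}" by auto
    then show "card {x \<in> A. c x = k} = card {y \<in> B - {b}. d y = k}"
      using insert.prems(1) insert.prems(4)[OF k] that unfolding ins
      by (cases "c a = k") (auto simp: card_Diff_singleton_if)
  qed
  have fin: "finite (?F A (B - {b}))" for b
  proof (rule finite_subset[of _ "A \<rightarrow>\<^sub>E B"])
    show "finite (A \<rightarrow>\<^sub>E B)" using insert.hyps insert.prems(1) by (simp add: finite_PiE)
  qed (auto simp: PiE_def)
  \<comment> \<open>Choose the image \<open>b\<close> of \<open>a\<close> first, then map the rest
    into \<open>B - {b}\<close>, where the fibre sizes match again.\<close>
  have "bij_betw (\<lambda>(b, f). f(a := b)) (SIGMA b:?B. ?F A (B - {b})) (?F (insert a A) B)"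
  proof (rule bij_betw_byWitness[where f' = "\<lambda>f. (f a, restrict f A)"])
    show "\<forall>p\<in>SIGMA b:?B. ?F A (B - {b}). (\<lambda>f. (f a, restrict f A)) ((\<lambda>(b, f). f(a := b)) p) = p"
      using insert.hyps(2) by (auto simp: PiE_def extensional_def fun_eq_iff)
    show "\<forall>f\<in>?F (insert a A) B. (\<lambda>(b, f). f(a := b)) (f a, restrict f A) = f"
      by (auto simp: PiE_def extensional_def fun_eq_iff)
    show "(\<lambda>(b, f). f(a := b)) ` (SIGMA b:?B. ?F A (B - {b})) \<subseteq> ?F (insert a A) B"
    proof clarify
      fix b f assume b: "b \<in> B" "d b = c a" and f: "f \<in> A \<rightarrow>\<^sub>E B - {b}" "inj_on f A" "\<forall>x\<in>A. d (f x) = c x"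
      have "b \<notin> f ` A" using f(1) by auto
      then have "inj_on (f(a := b)) (insert a A)"
        using insert.hyps(2) f(2) by (auto intro: inj_on_fun_updI)
      moreover have "f(a := b) \<in> insert a A \<rightarrow>\<^sub>E B"
        using b(1) f(1) by (auto simp: PiE_iff extensional_def)
      moreover have "\<forall>x\<in>insert a A. d ((f(a := b)) x) = c x"
        using b(2) f(3) by simp
      ultimately show "f(a := b) \<in> insert a A \<rightarrow>\<^sub>E B \<and> inj_on (f(a := b)) (insert a A) \<and>
        (\<forall>x\<in>insert a A. d ((f(a := b)) x) = c x)" by blast
    qed
    show "(\<lambda>f. (f a, restrict f A)) ` ?F (insert a A) B \<subseteq> (SIGMA b:?B. ?F A (B - {b}))"
    proof (rule image_subsetI)
      fix f assume "f \<in> ?F (insert a A) B"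
      then have f: "f \<in> insert a A \<rightarrow>\<^sub>E B" "inj_on f (insert a A)" "\<forall>x\<in>insert a A. d (f x) = c x"
        by blast+
      have "f x \<noteq> f a" if "x \<in> A" for x
        using f(2) insert.hyps(2) that by (metis inj_on_eq_iff insert_iff)
      then have "restrict f A \<in> A \<rightarrow>\<^sub>E B - {f a}" using f(1) by (auto simp: PiE_iff)
      moreover have "inj_on (restrict f A) A" using f(2) by simp
      moreover have "f a \<in> B" using f(1) by auto
      ultimately show "(f a, restrict f A) \<in> (SIGMA b:?B. ?F A (B - {b}))" using f(1,3) by simp
    qed
  qed
  then have "card (?F (insert a A) B) = card (SIGMA b:?B. ?F A (B - {b}))"
    by (rule bij_betw_same_card[symmetric])
  also have "\<dots> = (\<Sum>b\<in>?B. card (?F A (B - {b})))"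
    by (rule card_SigmaI) (use insert.prems fin in auto)
  also have "\<dots> = (\<Sum>b\<in>?B. \<Prod>k\<in>K. fact (card {x \<in> A. c x = k}))"
    using IH by (rule sum.cong[OF refl])
  also have "\<dots> = Suc ?m * (\<Prod>k\<in>K. fact (card {x \<in> A. c x = k}))" by (simp add: cB)
  \<comment> \<open>The factor \<open>Suc ?m\<close> is absorbed at the colour \<open>c a\<close>,
    where it turns m! into (m + 1)!; the other factors are unchanged.\<close>
  also have "\<dots> = (\<Prod>k\<in>K. fact (card {x \<in> insert a A. c x = k}))"
  proof -
    have "c a \<in> K" using insert.prems by auto
    moreover have "(\<Prod>k\<in>K - {c a}. fact (card {x \<in> A. c x = k} + (if c a = k then 1 else 0))) =
      (\<Prod>k\<in>K - {c a}. fact (card {x \<in> A. c x = k}) :: nat)"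
      by (rule prod.cong) auto
    ultimately show ?thesis
      using insert.prems(2) unfolding ins by (simp add: prod.remove[of K "c a"] algebra_simps)
  qed
  finally show ?case .
qed

text \<open>A function constant on the fibres of \<open>q\<close> factors uniquely through
  \<open>q\<close>; \<open>inv_into U q\<close> supplies a representative of each fibre for the
  inverse map.\<close>

lemma card_constant_on_fibres:
  assumes "finite U" "q ` U = W"
  shows "card {e \<in> U \<rightarrow>\<^sub>E T. \<forall>x\<in>U. \<forall>y\<in>U. q x = q y \<longrightarrow> e x = e y} = card T ^ card W"
proof -
  let ?E = "{e \<in> U \<rightarrow>\<^sub>E T. \<forall>x\<in>U. \<forall>y\<in>U. q x = q y \<longrightarrow> e x = e y}"
  have q: "inv_into U q w \<in> U" "q (inv_into U q w) = w" if "w \<in> W" for w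
    using that assms(2) by (auto intro: inv_into_into f_inv_into_f)
  have "bij_betw (\<lambda>h. \<lambda>x\<in>U. h (q x)) (W \<rightarrow>\<^sub>E T) ?E"
  proof (rule bij_betw_byWitness[where f' = "\<lambda>e. \<lambda>w\<in>W. e (inv_into U q w)"])
    show "\<forall>h\<in>W \<rightarrow>\<^sub>E T. (\<lambda>w\<in>W. (\<lambda>x\<in>U. h (q x)) (inv_into U q w)) = h"
    proof (intro ballI ext)
      fix h w assume h: "h \<in> W \<rightarrow>\<^sub>E T"
      show "(\<lambda>w\<in>W. (\<lambda>x\<in>U. h (q x)) (inv_into U q w)) w = h w"
      proof (cases "w \<in> W")
        case True
        then show ?thesis using q[OF True] by simp
      next
        case False
        then show ?thesis using PiE_arb[OF h] by simp
      qed
    qed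
    show "\<forall>e\<in>?E. (\<lambda>x\<in>U. (\<lambda>w\<in>W. e (inv_into U q w)) (q x)) = e"
    proof (intro ballI ext)
      fix e x assume e: "e \<in> ?E"
      show "(\<lambda>x\<in>U. (\<lambda>w\<in>W. e (inv_into U q w)) (q x)) x = e x"
      proof (cases "x \<in> U")
        case True
        then have w: "q x \<in> W" using assms(2) by auto
        have "e (inv_into U q (q x)) = e x" using e q[OF w] True by blast
        then show ?thesis using True w by simp
      next
        case False
        then show ?thesis using e PiE_arb[of e U "\<lambda>_. T"] by simp
      qed
    qed
    show "(\<lambda>h. \<lambda>x\<in>U. h (q x)) ` (W \<rightarrow>\<^sub>E T) \<subseteq> ?E"
      unfolding assms(2)[symmetric] by (auto simp: PiE_iff)
    show "(\<lambda>e. \<lambda>w\<in>W. e (inv_into U q w)) ` ?E \<subseteq> (W \<rightarrow>\<^sub>E T)"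
      by (intro image_subsetI restrict_PiE_iff[THEN iffD2] ballI) (use q(1) in \<open>simp add: PiE_iff\<close>)
  qed
  then have "card ?E = card (W \<rightarrow>\<^sub>E T)" by (rule bij_betw_same_card[symmetric])
  also have "\<dots> = card T ^ card W"
    using assms by (auto simp: card_PiE)
  finally show ?thesis .
qed

section \<open>Permutations preserving a family of disjoint blocks\<close>

text \<open>Completing the blocks by singletons gives a partition of \<open>U\<close>. The map
  \<open>q\<close> sends a point to its part: \<open>Inl B\<close> for a block, \<open>Inr x\<close>
  for an uncovered point. Since no block is empty, every label is attained.\<close>

lemma card_PiE_constant_on_blocks:
  assumes U: "finite U" and P: "\<Union>P \<subseteq> U" "disjoint P" "{} \<notin> P"
  shows "card {e \<in> U \<rightarrow>\<^sub>E T. \<forall>B\<in>P. \<forall>x\<in>B. \<forall>y\<in>B. e x = e y} =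
    card T ^ (card P + card (U - \<Union>P))"
proof -
  have blk: "(THE B. B \<in> P \<and> x \<in> B) = B" if "B \<in> P" "x \<in> B" for x B
    using that P(2) by (intro the_equality) (auto simp: disjoint_def)
  define q where "q x = (if x \<in> \<Union>P then Inl (THE B. B \<in> P \<and> x \<in> B) else Inr x)" for x
  have qI: "q x = Inl B" if "B \<in> P" "x \<in> B" for x B
    using that blk[OF that] by (auto simp: q_def)
  have qO: "q x = Inr x" if "x \<notin> \<Union>P" for x
    using that by (simp add: q_def)
  let ?W = "Inl ` P \<union> Inr ` (U - \<Union>P)"
  have W: "q ` U = ?W"
  proof (intro equalityI subsetI)
    fix w assume "w \<in> q ` U"
    then obtain x where x: "x \<in> U" "w = q x" by blast
    show "w \<in> ?W"
    proof (cases "x \<in> \<Union>P")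
      case True
      then obtain B where "B \<in> P" "x \<in> B" by blast
      then show ?thesis using qI x by auto
    qed (use qO x in auto)
  next
    fix w assume "w \<in> ?W"
    then consider B where "B \<in> P" "w = Inl B" | x where "x \<in> U - \<Union>P" "w = Inr x" by blast
    then show "w \<in> q ` U"
    proof cases
      case (1 B)
      then obtain x where "x \<in> B" using P(3) by (metis ex_in_conv)
      then have "w = q x" "x \<in> U" using 1 qI P(1) by auto
      then show ?thesis by blast
    next
      case (2 x)
      then have "w = q x" "x \<in> U" using qO[of x] by auto
      then show ?thesis by blast
    qed
  qed
  have finP: "finite P" using U P(1) by (meson finite_UnionD finite_subset)
  have eq: "(\<forall>B\<in>P. \<forall>x\<in>B. \<forall>y\<in>B. e x = e y) \<longleftrightarrow> (\<forall>x\<in>U. \<forall>y\<in>U. q x = q y \<longrightarrow> e x = e y)" for e :: "'a \<Rightarrow> 'b"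
  proof (intro iffI ballI impI)
    fix B x y assume h: "\<forall>x\<in>U. \<forall>y\<in>U. q x = q y \<longrightarrow> e x = e y" and "B \<in> P" "x \<in> B" "y \<in> B"
    then have "x \<in> U" "y \<in> U" "q x = q y" using P(1) qI by auto
    then show "e x = e y" using h by blast
  next
    fix x y assume h: "\<forall>B\<in>P. \<forall>x\<in>B. \<forall>y\<in>B. e x = e y" and xy: "x \<in> U" "y \<in> U" "q x = q y"
    show "e x = e y"
    proof (cases "x \<in> \<Union>P")
      case True
      then obtain B where B: "B \<in> P" "x \<in> B" by blast
      then have "q y = Inl B" using qI xy by simp
      then have "y \<in> B" using qI qO
        by (metis Inl_inject Inl_Inr_False UnionE)
      then show ?thesis using h B by blast
    next
      case False
      then have "q y = Inr x" using qO xy by simp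
      then have "y = x" using qI qO
        by (metis Inr_inject Inl_Inr_False UnionE)
      then show ?thesis by simp
    qed
  qed
  have "card ?W = card P + card (U - \<Union>P)"
    using finP U by (subst card_Un_disjoint) (auto simp: card_image)
  then show ?thesis
    unfolding eq card_constant_on_fibres[OF U W] by simp
qed

text \<open>Each such \<open>p\<close> induces a size-preserving permutation \<open>s\<close> of the
  blocks. For fixed \<open>s\<close>, the maps \<open>p\<close> are the bijections that send the
  colour \<open>s B\<close> of a point of \<open>B\<close> to the block containing the image, so
  both levels are instances of the coloured count, and the inner number does not depend on
  \<open>s\<close>.\<close>

lemma card_block_permutations:
  assumes U: "finite U" and P: "\<Union>P \<subseteq> U" "disjoint P" "{} \<notin> P"
    and I: "finite I" "card ` P \<subseteq> I"
  shows "card {p \<in> U \<rightarrow>\<^sub>E U. inj_on p U \<and> (\<forall>B\<in>P. p ` B \<in> P)} =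
    (\<Prod>i\<in>I. fact (card {B \<in> P. card B = i})) * ((\<Prod>B\<in>P. fact (card B)) * fact (card (U - \<Union>P)))"
proof -
  have finP: "finite P" using U P(1) by (meson finite_UnionD finite_subset)
  have finB: "finite B" if "B \<in> P" for B using that U P(1) by (meson Sup_upper finite_subset order_trans)
  \<comment> \<open>All uncovered points share the colour \<open>None\<close>, which makes them one
    further class that \<open>p\<close> must preserve.\<close>
  define blk where "blk x = (if x \<in> \<Union>P then Some (THE B. B \<in> P \<and> x \<in> B) else None)" for x
  have blk: "blk x = Some B \<longleftrightarrow> B \<in> P \<and> x \<in> B" for x B
  proof -
    have "(THE B. B \<in> P \<and> x \<in> B) = B" if "B \<in> P" "x \<in> B" for x B
      using that P(2) by (intro the_equality) (auto simp: disjoint_def)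
    then show ?thesis by (auto simp: blk_def)
  qed
  have blkN: "blk x = None \<longleftrightarrow> x \<notin> \<Union>P" for x by (simp add: blk_def)
  let ?S = "{s \<in> P \<rightarrow>\<^sub>E P. inj_on s P \<and> (\<forall>B\<in>P. card (s B) = card B)}"
  let ?F = "\<lambda>s. {p \<in> U \<rightarrow>\<^sub>E U. inj_on p U \<and> (\<forall>x\<in>U. blk (p x) = map_option s (blk x))}"
  have cS: "card ?S = (\<Prod>i\<in>I. fact (card {B \<in> P. card B = i}))"
    by (rule card_coloured_bijections) (use finP I in auto)
  have img: "p ` B = s B" if s: "s \<in> ?S" and p: "p \<in> ?F s" and B: "B \<in> P" for s p B
  proof (rule card_subset_eq)
    have sB: "s B \<in> P" "card (s B) = card B" using s B by auto
    show "finite (s B)" using finB sB by auto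
    have "p x \<in> s B" if "x \<in> B" for x
    proof -
      have "x \<in> U" using that B P(1) by auto
      then have "blk (p x) = map_option s (blk x)" using p by blast
      also have "blk x = Some B" using blk that B by blast
      finally show ?thesis using blk[of "p x" "s B"] by simp
    qed
    then show "p ` B \<subseteq> s B" by blast
    have "inj_on p B" using p B P(1) by (auto intro: inj_on_subset)
    then show "card (p ` B) = card (s B)" using sB by (simp add: card_image)
  qed
  have cF: "card (?F s) = (\<Prod>B\<in>P. fact (card B)) * fact (card (U - \<Union>P))" if s: "s \<in> ?S" for s
  proof -
    have "s ` P = P" using s finP by (intro endo_inj_surj) auto
    then have bij: "bij_betw s P P" using s by (simp add: bij_betw_def)
    have sel: "{x \<in> U. map_option s (blk x) = Some (s B)} = B" if "B \<in> P" for B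
    proof -
      have "map_option s (blk x) = Some (s B) \<longleftrightarrow> x \<in> B" for x
      proof
        assume "map_option s (blk x) = Some (s B)"
        then obtain B' where "blk x = Some B'" "s B' = s B" by auto
        then have "B' = B" "x \<in> B'" using blk bij that by (auto simp: bij_betw_def inj_on_def)
        then show "x \<in> B" by simp
      next
        assume "x \<in> B"
        then have "blk x = Some B" using blk that by blast
        then show "map_option s (blk x) = Some (s B)" by simp
      qed
      then show ?thesis using that P(1) by auto
    qed
    have sel': "{x \<in> U. blk x = Some B} = B" if "B \<in> P" for B
      using that P(1) by (auto simp: blk)
    have selN: "{x \<in> U. map_option s (blk x) = None} = U - \<Union>P" "{x \<in> U. blk x = None} = U - \<Union>P"
      by (auto simp: blkN)
    let ?K = "insert None (Some ` P)"
    have "card (?F s) = (\<Prod>k\<in>?K. fact (card {x \<in> U. map_option s (blk x) = k}))"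
    proof (rule card_coloured_bijections)
      show "(\<lambda>x. map_option s (blk x)) ` U \<subseteq> ?K"
      proof
        fix w assume "w \<in> (\<lambda>x. map_option s (blk x)) ` U"
        then obtain x where x: "w = map_option s (blk x)" by blast
        show "w \<in> ?K"
        proof (cases "blk x")
          case (Some B)
          then have "s B \<in> P" using blk s by auto
          then show ?thesis using Some x by simp
        qed (use x in simp)
      qed
      fix k assume "k \<in> ?K"
      then consider "k = None" | B where "B \<in> P" "k = Some (s B)"
        using bij by (auto simp: bij_betw_def)
      then show "card {x \<in> U. map_option s (blk x) = k} = card {y \<in> U. blk y = k}"
      proof cases
        case (2 B)
        then have "s B \<in> P" "card (s B) = card B" using s by auto
        then show ?thesis using 2 sel sel' by (simp del: map_option_eq_Some)
      qed (simp only: selN)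
    qed (use U finP in auto)
    also have "\<dots> = fact (card (U - \<Union>P)) * (\<Prod>B\<in>P. fact (card {x \<in> U. map_option s (blk x) = Some B}))"
      using finP by (simp add: selN prod.reindex del: map_option_eq_Some map_option_is_None None_eq_map_option_iff)
    \<comment> \<open>After reindexing by \<open>s\<close>, the points of colour
      \<open>Some (s B)\<close> are exactly those of \<open>B\<close>.\<close>
    also have "(\<Prod>B\<in>P. fact (card {x \<in> U. map_option s (blk x) = Some B})) = (\<Prod>B\<in>P. fact (card B))"
      by (subst prod.reindex_bij_betw[OF bij, symmetric])
        (auto simp: sel simp del: map_option_eq_Some intro!: prod.cong)
    finally show ?thesis by (simp only: mult.commute)
  qed
  have un: "{p \<in> U \<rightarrow>\<^sub>E U. inj_on p U \<and> (\<forall>B\<in>P. p ` B \<in> P)} = (\<Union>s\<in>?S. ?F s)" (is "?L = _")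
  proof (intro equalityI subsetI)
    fix p assume p: "p \<in> ?L"
    define s where "s = (\<lambda>B\<in>P. p ` B)"
    have BU: "B \<subseteq> U" if "B \<in> P" for B using that P(1) by auto
    have inj: "inj_on p U" using p by simp
    have sinj: "inj_on s P"
      using inj_on_image_eq_iff[OF inj] BU by (auto simp: s_def inj_on_def)
    have s: "s \<in> ?S"
      using p sinj BU by (auto simp: s_def card_image inj_on_subset[OF inj] simp del: inj_on_restrict_eq)
    then have "s ` P = P" using finP sinj by (intro endo_inj_surj) auto
    then have onto: "\<exists>B'\<in>P. p ` B' = B" if "B \<in> P" for B
      using that by (metis imageE restrict_apply' s_def)
    have "blk (p x) = map_option s (blk x)" if x: "x \<in> U" for x
    proof (cases "blk x")
      case (Some B)
      then have "B \<in> P" "x \<in> B" using blk by auto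
      then have "blk (p x) = Some (p ` B)" using p blk by auto
      then show ?thesis using Some \<open>B \<in> P\<close> by (simp add: s_def)
    next
      case None
      \<comment> \<open>The images of the blocks exhaust the blocks, so by injectivity a point sent
        into a block already lies in one.\<close>
      have "p x \<notin> \<Union>P"
      proof
        assume "p x \<in> \<Union>P"
        then obtain B' where B': "B' \<in> P" "p x \<in> p ` B'" using onto by blast
        then have "x \<in> B'" using inj x BU by (meson inj_on_image_mem_iff)
        then show False using None B' blkN by auto
      qed
      then have "blk (p x) = None" using blkN by blast
      then show ?thesis using None by (simp only: option.map)
    qed
    then show "p \<in> (\<Union>s\<in>?S. ?F s)" using s p by blast
  next
    fix p assume "p \<in> (\<Union>s\<in>?S. ?F s)"
    then obtain s where s: "s \<in> ?S" and p: "p \<in> ?F s" by blast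
    have "p ` B \<in> P" if "B \<in> P" for B
      using img[OF s p that] s that by auto
    then show "p \<in> ?L" using p by blast
  qed
  have "card ?L = (\<Sum>s\<in>?S. card (?F s))"
    unfolding un
  proof (rule card_UN_disjoint)
    show "finite ?S" using finP by (intro finite_subset[OF _ finite_PiE[of P "\<lambda>_. P"]]) auto
    show "\<forall>s\<in>?S. finite (?F s)" using U by (intro ballI finite_subset[OF _ finite_PiE[of U "\<lambda>_. U"]]) auto
    show "\<forall>s\<in>?S. \<forall>s'\<in>?S. s \<noteq> s' \<longrightarrow> ?F s \<inter> ?F s' = {}"
    proof (intro ballI impI)
      fix s s' assume s: "s \<in> ?S" "s' \<in> ?S" "s \<noteq> s'"
      \<comment> \<open>The block permutation can be read off from the images of the blocks under
        \<open>p\<close>.\<close>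
      have "s = s'" if "p \<in> ?F s" "p \<in> ?F s'" for p
      proof (rule PiE_ext[of s P "\<lambda>_. P" s'])
        show "s B = s' B" if "B \<in> P" for B
          using img[OF s(1) \<open>p \<in> ?F s\<close> that] img[OF s(2) \<open>p \<in> ?F s'\<close> that] by simp
      qed (use s(1,2) in auto)
      then show "?F s \<inter> ?F s' = {}" using s(3) by blast
    qed
  qed
  also have "\<dots> = card ?S * ((\<Prod>B\<in>P. fact (card B)) * fact (card (U - \<Union>P)))"
    by (subst sum.cong[OF refl cF]) simp_all
  finally show ?thesis unfolding cS .
qed

section \<open>Automorphisms of the cube as signed permutations\<close>

definition neg_lit :: "'a \<times> bool \<Rightarrow> 'a \<times> bool" where
  "neg_lit l = (fst l, \<not> snd l)"

definition literals :: "nat \<Rightarrow> (nat \<times> bool) set" where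
  "literals n = {1..n} \<times> UNIV"

definition consistent :: "nat \<Rightarrow> (nat \<times> bool) set set" where
  "consistent n = {L. L \<subseteq> literals n \<and> L \<inter> neg_lit ` L = {}}"

text \<open>A face \<open>(X1, X2)\<close> is encoded by a set of literals, where \<open>(i, True)\<close> stands for
  \<open>i \<in> X1\<close> if \<open>s i\<close> holds and for \<open>i \<in> X2\<close> otherwise. The free choice of the orientation \<open>s\<close>
  allows all literals of a coatom of a subalgebra to be given the same sign.\<close>

definition lits :: "(nat \<Rightarrow> bool) \<Rightarrow> nat set \<times> nat set \<Rightarrow> (nat \<times> bool) set" where
  "lits s x = {(i, b). i \<in> (if s i = b then fst x else snd x)}"

definition unlits :: "(nat \<Rightarrow> bool) \<Rightarrow> (nat \<times> bool) set \<Rightarrow> nat set \<times> nat set" where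
  "unlits s L = ({i. (i, s i) \<in> L}, {i. (i, \<not> s i) \<in> L})"

lemma neg_lit_Pair: "neg_lit (i, b) = (i, \<not> b)"
  by (simp add: neg_lit_def)

lemma neg_lit_neg_lit [simp]: "neg_lit (neg_lit l) = l"
  by (simp add: neg_lit_def)

lemma neg_lit_eq_iff [simp]: "neg_lit k = neg_lit l \<longleftrightarrow> k = l"
  by (metis neg_lit_neg_lit)

lemma neg_lit_neq [simp]: "neg_lit l \<noteq> l" "l \<noteq> neg_lit l"
  by (cases l; simp add: neg_lit_def)+

lemma neg_lit_image_iff: "l \<in> neg_lit ` L \<longleftrightarrow> neg_lit l \<in> L"
  by (metis image_iff neg_lit_neg_lit)

lemma neg_lit_in_literals [simp]: "neg_lit l \<in> literals n \<longleftrightarrow> l \<in> literals n"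
  by (cases l) (simp add: literals_def neg_lit_def)

lemma consistentD:
  assumes "L \<in> consistent n"
  shows "L \<subseteq> literals n" and "l \<in> L \<Longrightarrow> neg_lit l \<notin> L"
  using assms by (auto simp: consistent_def neg_lit_image_iff)

lemma consistentI:
  assumes "L \<subseteq> literals n" "\<And>l. l \<in> L \<Longrightarrow> neg_lit l \<notin> L"
  shows "L \<in> consistent n"
  using assms by (auto simp: consistent_def)

lemma consistent_subset: "L \<in> consistent n \<Longrightarrow> M \<subseteq> L \<Longrightarrow> M \<in> consistent n"
  by (auto simp: consistent_def)

lemma singleton_consistent: "l \<in> literals n \<Longrightarrow> {l} \<in> consistent n"
  by (simp add: consistent_def)

lemma lits_unlits [simp]: "lits s (unlits s L) = L"
  by (auto simp: lits_def unlits_def split: if_splits)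

lemma unlits_lits [simp]: "unlits s (lits s x) = x"
  by (cases x) (auto simp: lits_def unlits_def)

lemma lits_inject [simp]: "lits s x = lits s y \<longleftrightarrow> x = y"
  by (metis unlits_lits)

lemma lits_iff: "(i, b) \<in> lits s (X1, X2) \<longleftrightarrow> i \<in> (if s i = b then X1 else X2)"
  by (simp add: lits_def)

lemma lits_consistent [simp]: "lits s x \<in> consistent n \<longleftrightarrow> x \<in> carrier (cube n)"
proof -
  obtain X1 X2 where x: "x = (X1, X2)" by (cases x)
  show ?thesis
  proof
    assume c: "lits s x \<in> consistent n"
    have "i \<in> {1..n}" if "i \<in> X1" for i
      using consistentD(1)[OF c, THEN subsetD, of "(i, s i)"] that by (simp add: x lits_iff literals_def)
    moreover have "i \<in> {1..n}" if "i \<in> X2" for i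
      using consistentD(1)[OF c, THEN subsetD, of "(i, \<not> s i)"] that by (simp add: x lits_iff literals_def)
    moreover have "i \<notin> X2" if "i \<in> X1" for i
      using consistentD(2)[OF c, of "(i, s i)"] that by (simp add: x lits_iff neg_lit_Pair)
    ultimately show "x \<in> carrier (cube n)" unfolding x cube_carrier by blast
  next
    assume "x \<in> carrier (cube n)"
    then show "lits s x \<in> consistent n"
      unfolding x cube_carrier by (intro consistentI) (auto simp: lits_iff literals_def neg_lit_Pair subset_iff split: if_splits)
  qed
qed

lemma unlits_carrier [simp]: "unlits s L \<in> carrier (cube n) \<longleftrightarrow> L \<in> consistent n"
  by (metis lits_consistent lits_unlits)

text \<open>The encoding reverses the order: a smaller face fixes more coordinates and so carries
  more literals. Maximal faces become minimal sets from here on.\<close>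

lemma cube_le_iff_lits: "x \<sqsubseteq>\<^bsub>cube n\<^esub> y \<longleftrightarrow> lits s y \<subseteq> lits s x"
proof -
  obtain X1 X2 Y1 Y2 where [simp]: "x = (X1, X2)" "y = (Y1, Y2)" by (cases x, cases y)
  have "lits s y \<subseteq> lits s x \<longleftrightarrow> (\<forall>i. (i, s i) \<in> lits s y \<longrightarrow> (i, s i) \<in> lits s x) \<and>
      (\<forall>i. (i, \<not> s i) \<in> lits s y \<longrightarrow> (i, \<not> s i) \<in> lits s x)"
  proof (intro iffI subsetI)
    fix l assume l: "l \<in> lits s y" and h: "(\<forall>i. (i, s i) \<in> lits s y \<longrightarrow> (i, s i) \<in> lits s x) \<and>
      (\<forall>i. (i, \<not> s i) \<in> lits s y \<longrightarrow> (i, \<not> s i) \<in> lits s x)"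
    obtain i b where "l = (i, b)" by (cases l)
    then show "l \<in> lits s x" using l h by (cases "b = s i") auto
  qed blast
  then show ?thesis by (auto simp: lits_iff)
qed

lemma lits_cube_top [simp]: "lits s cube_top = {}"
  by (auto simp: cube_top_def lits_iff)

lemma lits_reflect: "lits s (reflect x y) = lits s x \<union> neg_lit ` (lits s y - lits s x)"
  by (cases x; cases y) (auto simp: lits_iff neg_lit_image_iff neg_lit_Pair)

text \<open>The formula defining \<open>reflect\<close> makes sense for any two faces, and the caret
  is that formula without the restriction to y \<le> x.\<close>

lemma lits_caret:
  assumes "x \<in> carrier (cube n)" "y \<in> carrier (cube n)"
  shows "lits s (caret n x y) = lits s x \<union> neg_lit ` (lits s y - lits s x)"
proof -
  have "caret n x y = reflect x y"
    using assms by (cases x; cases y) (simp only: caret_cube reflect_Pair)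
  then show ?thesis by (simp only: lits_reflect)
qed

lemma lits_join:
  assumes "x \<in> carrier (cube n)" "y \<in> carrier (cube n)"
  shows "lits s (x \<squnion>\<^bsub>cube n\<^esub> y) = lits s x \<inter> lits s y"
  using assms by (cases x; cases y) (auto simp: join_cube lits_iff simp del: cube_carrier split: if_splits)

text \<open>This is the hyperoctahedral group acting on the 2n literals. Injectivity is enough for
  bijectivity because the set is finite, and extensionality makes each element count once.\<close>

definition signed_perms :: "nat \<Rightarrow> (nat \<times> bool \<Rightarrow> nat \<times> bool) set" where
  "signed_perms n = {g \<in> literals n \<rightarrow>\<^sub>E literals n. inj_on g (literals n) \<and>
     (\<forall>l\<in>literals n. g (neg_lit l) = neg_lit (g l))}"

definition induced_auto ::
  "nat \<Rightarrow> (nat \<Rightarrow> bool) \<Rightarrow> (nat \<times> bool \<Rightarrow> nat \<times> bool) \<Rightarrow> nat set \<times> nat set \<Rightarrow> nat set \<times> nat set" where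
  "induced_auto n s g = (\<lambda>x\<in>carrier (cube n). unlits s (g ` lits s x))"

lemma signed_perm_image_neg:
  assumes "g \<in> signed_perms n" "L \<subseteq> literals n"
  shows "g ` neg_lit ` L = neg_lit ` g ` L"
proof -
  have "g (neg_lit l) = neg_lit (g l)" if "l \<in> L" for l
    using assms that by (auto simp: signed_perms_def)
  then show ?thesis by (simp add: image_image)
qed

lemma signed_perm_image_consistent:
  assumes g: "g \<in> signed_perms n" and L: "L \<in> consistent n"
  shows "g ` L \<in> consistent n"
proof -
  have LU: "L \<subseteq> literals n" and dis: "L \<inter> neg_lit ` L = {}" using L by (auto simp: consistent_def)
  have "neg_lit ` L \<subseteq> literals n" using LU by auto
  then have "g ` L \<inter> g ` neg_lit ` L = g ` (L \<inter> neg_lit ` L)"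
    using g LU by (intro inj_on_image_Int[symmetric, of g "literals n"]) (auto simp: signed_perms_def)
  then have "g ` L \<inter> neg_lit ` g ` L = {}"
    using dis by (simp add: signed_perm_image_neg[OF g LU])
  moreover have "g ` L \<subseteq> literals n" using g LU by (auto simp: signed_perms_def)
  ultimately show ?thesis by (simp add: consistent_def)
qed

lemma lits_induced_auto:
  "x \<in> carrier (cube n) \<Longrightarrow> lits s (induced_auto n s g x) = g ` lits s x"
  by (simp add: induced_auto_def)

text \<open>Order and reflection are expressed by inclusion, union, difference and negation of sets
  of literals, and the image under an injective map commuting with negation respects all of these.
  Surjectivity on faces follows from injectivity by finiteness.\<close>

lemma induced_auto_in_cube_auto:
  assumes g: "g \<in> signed_perms n"
  shows "induced_auto n s g \<in> cube_auto n"
proof -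
  let ?f = "induced_auto n s g" and ?S = "carrier (cube n)"
  have inj: "inj_on g (literals n)" using g by (simp add: signed_perms_def)
  have L: "lits s x \<subseteq> literals n" if "x \<in> ?S" for x
    using that by (intro consistentD(1)) simp
  have cl: "?f x \<in> ?S" if "x \<in> ?S" for x
  proof -
    have "lits s (?f x) \<in> consistent n"
      using that g by (simp only: lits_induced_auto) (intro signed_perm_image_consistent, auto)
    then show ?thesis by simp
  qed
  have image_sub: "g ` M \<subseteq> g ` N \<longleftrightarrow> M \<subseteq> N" if "M \<subseteq> literals n" "N \<subseteq> literals n" for M N
  proof
    assume sub: "g ` M \<subseteq> g ` N"
    show "M \<subseteq> N"
    proof
      fix l assume "l \<in> M"
      then have "g l \<in> g ` N" "l \<in> literals n" using sub that by blast+
      then show "l \<in> N" using inj_on_image_mem_iff[OF inj _ that(2)] by blast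
    qed
  qed (rule image_mono)
  have le: "?f x \<sqsubseteq>\<^bsub>cube n\<^esub> ?f y \<longleftrightarrow> x \<sqsubseteq>\<^bsub>cube n\<^esub> y" if "x \<in> ?S" "y \<in> ?S" for x y
    using that L by (simp add: cube_le_iff_lits[of n _ _ s] lits_induced_auto image_sub)
  have "inj_on ?f ?S"
  proof (rule inj_onI)
    fix x y assume xy: "x \<in> ?S" "y \<in> ?S" "?f x = ?f y"
    then have "g ` lits s x = g ` lits s y" by (metis lits_induced_auto)
    then show "x = y" using L xy inj_on_image_eq_iff[OF inj] by auto
  qed
  moreover from this have "?f ` ?S = ?S"
    using cl by (intro endo_inj_surj finite_cube) auto
  ultimately have "?f \<in> Bij ?S" by (simp add: Bij_def bij_betw_def induced_auto_def)
  moreover have "?f (reflect x y) = reflect (?f x) (?f y)"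
    if xy: "x \<in> ?S" "y \<in> ?S" "y \<sqsubseteq>\<^bsub>cube n\<^esub> x" for x y
  proof -
    have "lits s (?f (reflect x y)) = g ` (lits s x \<union> neg_lit ` (lits s y - lits s x))"
      using reflect_closed(1)[OF xy] by (simp only: lits_induced_auto lits_reflect)
    also have "\<dots> = g ` lits s x \<union> neg_lit ` g ` (lits s y - lits s x)"
    proof -
      have "lits s y - lits s x \<subseteq> literals n" using L[OF xy(2)] by blast
      then show ?thesis by (simp only: image_Un signed_perm_image_neg[OF g])
    qed
    also have "g ` (lits s y - lits s x) = g ` lits s y - g ` lits s x"
      by (rule inj_on_image_set_diff[OF inj order_trans[OF Diff_subset L[OF xy(2)]] L[OF xy(1)]])
    also have "g ` lits s x \<union> neg_lit ` (g ` lits s y - g ` lits s x) = lits s (reflect (?f x) (?f y))"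
      using xy by (simp only: lits_induced_auto lits_reflect)
    finally show ?thesis by simp
  qed
  ultimately show ?thesis using le by (simp add: cube_auto_def)
qed

text \<open>Transported to consistent sets, \<open>f\<close> becomes an order isomorphism
  \<open>F\<close> for inclusion. It fixes the least element and hence permutes the singletons just
  above it; this permutation is \<open>g\<close>. Compatibility with negation comes from the
  reflection at the top face.\<close>

lemma cube_auto_is_induced:
  assumes f: "f \<in> cube_auto n"
  shows "\<exists>g\<in>signed_perms n. induced_auto n s g = f"
proof -
  let ?S = "carrier (cube n)"
  have fB: "f \<in> Bij ?S" using f by (simp add: cube_auto_def)
  then have bij: "bij_betw f ?S ?S" by (simp add: Bij_def)
  define F where "F L = lits s (f (unlits s L))" for L
  have F_cl: "F L \<in> consistent n" if "L \<in> consistent n" for L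
    unfolding F_def lits_consistent using that by (intro cube_autoD(1)[OF f, of _ "unlits s L"]) simp_all
  have F_le: "F L \<subseteq> F M \<longleftrightarrow> L \<subseteq> M" if "L \<in> consistent n" "M \<in> consistent n" for L M
    using that cube_autoD(2)[OF f, of "unlits s M" "unlits s L"]
    by (simp add: F_def cube_le_iff_lits[of n _ _ s])
  have F_surj: "\<exists>L\<in>consistent n. F L = M" if "M \<in> consistent n" for M
  proof -
    have "unlits s M \<in> f ` ?S" using that bij by (simp add: bij_betw_def)
    then obtain x where "x \<in> ?S" "f x = unlits s M" by force
    then have "F (lits s x) = M" "lits s x \<in> consistent n" by (simp_all add: F_def)
    then show ?thesis by blast
  qed
  have F_eq: "F L = F M \<longleftrightarrow> L = M" if "L \<in> consistent n" "M \<in> consistent n" for L M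
    using F_le that by (metis subset_antisym order_refl)
  have e: "{} \<in> consistent n" by (simp add: consistent_def)
  have F0: "F {} = {}"
  proof -
    obtain L where "L \<in> consistent n" "F L = {}" using F_surj[OF e] by blast
    then show ?thesis using F_le[OF e] by blast
  qed
  have single: "\<exists>l. M = {l} \<and> l \<in> literals n" if "M \<in> consistent n" "F M = {m}" for M m
  proof -
    have "M \<noteq> {}" using that F0 by auto
    then obtain l where l: "l \<in> M" by blast
    then have lc: "{l} \<in> consistent n" using consistent_subset[OF that(1)] by simp
    have "F {l} \<subseteq> {m}" using F_le[OF lc that(1)] l that(2) by simp
    moreover have "F {l} \<noteq> {}" using F_eq[OF lc e] F0 by simp
    ultimately have "F {l} = F M" using that(2) by (simp add: subset_singleton_iff)
    then have "M = {l}" using F_eq[OF lc that(1)] by simp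
    then show ?thesis using lc by (auto simp: consistent_def)
  qed
  have preimage: "\<exists>l\<in>literals n. F {l} = {m}" if "m \<in> literals n" for m
    using F_surj[OF singleton_consistent[OF that]] single by metis
  \<comment> \<open>So far only preimages of singletons are known to be singletons. Any
    \<open>m\<close> in \<open>F {l}\<close> has such a preimage \<open>{k}\<close>, which must lie
    inside \<open>{l}\<close>.\<close>
  have atom: "\<exists>m\<in>literals n. F {l} = {m}" if l: "l \<in> literals n" for l
  proof -
    have lc: "{l} \<in> consistent n" using l by (rule singleton_consistent)
    have "F {l} \<noteq> {}" using F_eq[OF lc e] F0 by simp
    then obtain m where m: "m \<in> F {l}" by blast
    then have mU: "m \<in> literals n" using F_cl[OF lc] consistentD(1) by blast
    then obtain k where k: "k \<in> literals n" "F {k} = {m}" using preimage by blast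
    then have "F {k} \<subseteq> F {l}" using m by simp
    then have "k = l" using F_le[OF singleton_consistent[OF k(1)] lc] by simp
    then show ?thesis using k mU by blast
  qed
  then obtain h where h: "F {l} = {h l}" "h l \<in> literals n" if "l \<in> literals n" for l by metis
  define g where "g = restrict h (literals n)"
  have g: "F {l} = {g l}" "g l \<in> literals n" if "l \<in> literals n" for l
    using h[OF that] that by (simp_all add: g_def)
  have F_image: "F L = g ` L" if L: "L \<in> consistent n" for L
  proof (intro equalityI subsetI)
    fix m assume m: "m \<in> F L"
    then have "m \<in> literals n" using F_cl[OF L] consistentD(1) by blast
    then obtain l where l: "l \<in> literals n" "F {l} = {m}" using preimage by blast
    then have "{l} \<subseteq> L" using F_le[OF singleton_consistent[OF l(1)] L] m by simp
    then show "m \<in> g ` L" using g(1)[OF l(1)] l(2) by auto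
  next
    fix m assume "m \<in> g ` L"
    then obtain l where l: "l \<in> L" "m = g l" by blast
    then have lU: "l \<in> literals n" using consistentD(1)[OF L] by blast
    then have "F {l} \<subseteq> F L" using F_le[OF singleton_consistent[OF lU] L] l by simp
    then show "m \<in> F L" using g(1)[OF lU] l by simp
  qed
  have "inj_on g (literals n)"
  proof (rule inj_onI)
    fix k l assume kl: "k \<in> literals n" "l \<in> literals n" "g k = g l"
    then have "F {k} = F {l}" using g(1) by simp
    then show "k = l" using F_eq[OF singleton_consistent[OF kl(1)] singleton_consistent[OF kl(2)]] by simp
  qed
  moreover have "g (neg_lit l) = neg_lit (g l)" if l: "l \<in> literals n" for l
  proof -
    let ?x = "unlits s {l}"
    have x: "?x \<in> ?S" using singleton_consistent[OF l] by simp
    have t: "cube_top \<in> ?S" by (simp add: cube_top_def)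
    have le: "?x \<sqsubseteq>\<^bsub>cube n\<^esub> cube_top" by (simp add: cube_le_iff_lits[of n _ _ s])
    have ft: "f cube_top = cube_top"
      using F0 unfolding F_def by (metis lits_cube_top lits_inject unlits_lits)
    have "unlits s {neg_lit l} = reflect cube_top ?x"
      \<comment> \<open>Negating a literal is reflecting its face through the centre of the whole
        cube, which \<open>f\<close> fixes.\<close>
      using lits_reflect[of s cube_top ?x] by (metis Diff_empty image_empty image_insert lits_cube_top lits_unlits sup_bot_left unlits_lits)
    then have "F {neg_lit l} = lits s (f (reflect cube_top ?x))" by (simp add: F_def)
    also have "\<dots> = lits s (reflect cube_top (f ?x))"
      by (simp only: cube_autoD(3)[OF f t x le] ft)
    also have "\<dots> = neg_lit ` F {l}" by (simp add: lits_reflect F_def)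
    finally show ?thesis using l by (simp add: g(1))
  qed
  moreover have "g \<in> literals n \<rightarrow>\<^sub>E literals n" using g(2) by (auto simp: g_def)
  ultimately have gs: "g \<in> signed_perms n" by (simp add: signed_perms_def)
  have "induced_auto n s g = f"
  proof (rule extensionalityI)
    show "induced_auto n s g \<in> extensional ?S" by (simp add: induced_auto_def)
    show "f \<in> extensional ?S" using fB by (rule Bij_imp_extensional)
    fix x assume x: "x \<in> ?S"
    have "lits s (induced_auto n s g x) = F (lits s x)" using x by (simp add: lits_induced_auto F_image)
    then show "induced_auto n s g x = f x" by (simp add: F_def)
  qed
  then show ?thesis using gs by blast
qed

lemma bij_betw_induced_auto: "bij_betw (induced_auto n s) (signed_perms n) (cube_auto n)"
  unfolding bij_betw_def
proof
  show "inj_on (induced_auto n s) (signed_perms n)"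
  proof (rule inj_onI)
    fix g h assume gh: "g \<in> signed_perms n" "h \<in> signed_perms n" "induced_auto n s g = induced_auto n s h"
    show "g = h"
    proof (rule PiE_ext[of g "literals n" "\<lambda>_. literals n" h])
      fix l assume "l \<in> literals n"
      then have "unlits s {l} \<in> carrier (cube n)" by (simp add: singleton_consistent)
      then have "g ` lits s (unlits s {l}) = h ` lits s (unlits s {l})"
        using gh(3) by (metis lits_induced_auto)
      then show "g l = h l" by simp
    qed (use gh(1,2) in \<open>simp_all add: signed_perms_def\<close>)
  qed
  show "induced_auto n s ` signed_perms n = cube_auto n"
    using induced_auto_in_cube_auto cube_auto_is_induced by (metis (no_types, lifting) image_iff subsetI subset_antisym)
qed

section \<open>Counting the signed permutations that preserve a family of blocks\<close>

definition block_stabilizer :: "nat \<Rightarrow> nat set set \<Rightarrow> (nat \<times> bool \<Rightarrow> nat \<times> bool) set" where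
  "block_stabilizer n P =
    {g \<in> signed_perms n. \<forall>B\<in>P. \<forall>b. \<exists>B'\<in>P. \<exists>b'. g ` (B \<times> {b}) = B' \<times> {b'}}"

text \<open>A signed permutation is determined by its values on the positive literals:
  \<open>p\<close> records the index and \<open>e\<close> the sign, with \<open>e i\<close> true
  when the sign is kept. Then B \<times> {b} has a single sign in its image exactly when
  \<open>e\<close> is constant on \<open>B\<close>.\<close>

lemma card_block_stabilizer:
  assumes P: "\<Union>P \<subseteq> {1..n}" "{} \<notin> P"
  shows "card (block_stabilizer n P) =
    card {p \<in> {1..n} \<rightarrow>\<^sub>E {1..n}. inj_on p {1..n} \<and> (\<forall>B\<in>P. p ` B \<in> P)} *
    card {e \<in> {1..n} \<rightarrow>\<^sub>E (UNIV :: bool set). \<forall>B\<in>P. \<forall>x\<in>B. \<forall>y\<in>B. e x = e y}"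
    (is "_ = card ?p * card ?e")
proof -
  let ?U = "{1..n}"
  define G where "G = (\<lambda>(p, e). \<lambda>l\<in>literals n. (p (fst l) :: nat, snd l = (e (fst l) :: bool)))"
  define H where "H g = (\<lambda>i\<in>?U. fst (g (i, True)), \<lambda>i\<in>?U. snd (g (i, True)))"
    for g :: "nat \<times> bool \<Rightarrow> nat \<times> bool"
  have G: "G (p, e) (i, b) = (p i, b = e i)" if "i \<in> ?U" for p e i b
    using that by (simp add: G_def literals_def)
  have G_block: "G (p, e) ` (B \<times> {b}) = (\<lambda>i. (p i, b = e i)) ` B" if "B \<in> P" for p e B b
  proof -
    have "G (p, e) ` (B \<times> {b}) = (\<lambda>i. G (p, e) (i, b)) ` B" by force
    also have "\<dots> = (\<lambda>i. (p i, b = e i)) ` B"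
      using that P(1) by (intro image_cong refl G) auto
    finally show ?thesis .
  qed
  have GS: "G (p, e) \<in> block_stabilizer n P" if p: "p \<in> ?p" and e: "e \<in> ?e" for p e
  proof -
    have pU: "p i \<in> ?U" if "i \<in> ?U" for i using PiE_mem[of p ?U "\<lambda>_. ?U" i] p that by blast
    have "G (p, e) \<in> literals n \<rightarrow>\<^sub>E literals n"
      using pU by (auto simp: G_def literals_def)
    moreover have "inj_on (G (p, e)) (literals n)"
    proof (rule inj_onI)
      fix k l assume kl: "k \<in> literals n" "l \<in> literals n" "G (p, e) k = G (p, e) l"
      obtain i b j c where [simp]: "k = (i, b)" "l = (j, c)" by (cases k, cases l)
      have ij: "i \<in> ?U" "j \<in> ?U" using kl by (auto simp: literals_def)
      then have eq: "p i = p j" "(b = e i) = (c = e j)" using kl(3) by (simp_all add: G del: atLeastAtMost_iff)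
      moreover have "inj_on p ?U" using p by simp
      ultimately have "i = j" using ij inj_onD[of p ?U i j] by blast
      then show "k = l" using eq by auto
    qed
    moreover have "G (p, e) (neg_lit l) = neg_lit (G (p, e) l)" if "l \<in> literals n" for l
      using that by (cases l) (auto simp: G neg_lit_Pair literals_def)
    ultimately have "G (p, e) \<in> signed_perms n" by (simp add: signed_perms_def)
    moreover have "\<exists>B'\<in>P. \<exists>b'. G (p, e) ` (B \<times> {b}) = B' \<times> {b'}" if B: "B \<in> P" for B b
    proof -
      obtain j where j: "j \<in> B" using B P(2) by (metis ex_in_conv)
      then have "e i = e j" if "i \<in> B" for i using e B that by blast
      then have "G (p, e) ` (B \<times> {b}) = (\<lambda>i. (p i, b = e j)) ` B"
        unfolding G_block[OF B] by simp
      also have "\<dots> = p ` B \<times> {b = e j}" by auto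
      finally show ?thesis using p B by blast
    qed
    ultimately show ?thesis by (simp add: block_stabilizer_def)
  qed
  have H: "H g \<in> ?p \<times> ?e" "G (H g) = g" if g: "g \<in> block_stabilizer n P" for g
  proof -
    have gs: "g \<in> signed_perms n" using g by (simp add: block_stabilizer_def)
    have gU: "g l \<in> literals n" if "l \<in> literals n" for l
      using gs that by (auto simp: signed_perms_def)
    have gneg: "g (neg_lit l) = neg_lit (g l)" if "l \<in> literals n" for l
      using gs that by (simp add: signed_perms_def)
    obtain p e where pe: "H g = (p, e)" by (cases "H g")
    have pi: "p i = fst (g (i, True))" and ei: "e i = snd (g (i, True))" if "i \<in> ?U" for i
      using pe that by (auto simp: H_def)
    have gpe: "g (i, b) = (p i, b = e i)" if "i \<in> ?U" for i b
      using that gneg[of "(i, True)"]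
      by (cases b) (auto simp: pi ei neg_lit_def literals_def)
    have Ggpe: "G (p, e) = g"
    proof (rule extensionalityI[of _ "literals n"])
      show "G (p, e) \<in> extensional (literals n)" by (simp add: G_def)
      show "g \<in> extensional (literals n)" using gs by (auto simp: signed_perms_def PiE_def)
      fix l assume "l \<in> literals n"
      then show "G (p, e) l = g l" by (cases l) (simp add: literals_def G gpe del: atLeastAtMost_iff)
    qed
    then show "G (H g) = g" using pe by simp
    have "p i \<in> ?U" if "i \<in> ?U" for i
      using gU[of "(i, True)"] gpe[OF that] that by (simp add: literals_def del: atLeastAtMost_iff)
    then have pU: "p \<in> ?U \<rightarrow>\<^sub>E ?U" using pe by (auto simp: H_def)
    have pinj: "inj_on p ?U"
    proof (rule inj_onI)
      fix i j assume ij: "i \<in> ?U" "j \<in> ?U" "p i = p j"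
      \<comment> \<open>The sign \<open>e i = e j\<close> solves \<open>(b = e j) = e i\<close> for
        \<open>b\<close>, so these two literals have the same image.\<close>
      then have "g (i, True) = g (j, e i = e j)"
        unfolding gpe[OF ij(1)] gpe[OF ij(2)] by auto
      with gs have "inj_on g (literals n)" "g (i, True) = g (j, e i = e j)"
        by (simp_all add: signed_perms_def)
      moreover have "(i, True) \<in> literals n" "(j, e i = e j) \<in> literals n"
        using ij by (simp_all add: literals_def)
      ultimately have "(i, True) = (j, e i = e j)" by (rule inj_onD)
      then show "i = j" by simp
    qed
    have block: "p ` B \<in> P \<and> (\<forall>x\<in>B. \<forall>y\<in>B. e x = e y)" if B: "B \<in> P" for B
    proof -
      \<comment> \<open>The positive copy of the block already gives both conditions: its first
        projection the image of \<open>B\<close>, its second the constancy of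
        \<open>e\<close>.\<close>
      obtain B' b' where B': "B' \<in> P" "g ` (B \<times> {True}) = B' \<times> {b'}"
        using g B unfolding block_stabilizer_def by blast
      have eq: "(\<lambda>i. (p i, True = e i)) ` B = B' \<times> {b'}"
        using B'(2) G_block[OF B, of p e True] Ggpe by simp
      have "p ` B = fst ` ((\<lambda>i. (p i, True = e i)) ` B)" by (simp add: image_image)
      also have "\<dots> = B'" unfolding eq by simp
      finally have "p ` B = B'" .
      moreover have "e i = b'" if "i \<in> B" for i
      proof -
        have "(p i, True = e i) \<in> B' \<times> {b'}" using that unfolding eq[symmetric] by blast
        then show ?thesis by simp
      qed
      ultimately show ?thesis using B'(1) by simp
    qed
    have "e \<in> ?U \<rightarrow>\<^sub>E UNIV" using pe by (auto simp: H_def)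
    then have "e \<in> ?e" using block by blast
    moreover have "p \<in> ?p" using pU pinj block by blast
    ultimately show "H g \<in> ?p \<times> ?e" unfolding pe by (intro SigmaI)
  qed
  have HG: "H (G x) = x" if x: "x \<in> ?p \<times> ?e" for x
  proof -
    obtain p e where x': "x = (p, e)" by (cases x)
    have "(\<lambda>i\<in>?U. fst (G (p, e) (i, True))) = p"
      using x PiE_arb[of p ?U "\<lambda>_. ?U"] by (auto simp: x' fun_eq_iff G simp del: atLeastAtMost_iff)
    moreover have "(\<lambda>i\<in>?U. snd (G (p, e) (i, True))) = e"
      using x PiE_arb[of e ?U "\<lambda>_. UNIV"] by (auto simp: x' fun_eq_iff G simp del: atLeastAtMost_iff)
    ultimately show ?thesis by (simp add: x' H_def)
  qed
  have "bij_betw G (?p \<times> ?e) (block_stabilizer n P)"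
  proof (rule bij_betw_byWitness[where f' = H])
    show "\<forall>x\<in>?p \<times> ?e. H (G x) = x" using HG by blast
    show "\<forall>g\<in>block_stabilizer n P. G (H g) = g" using H(2) by blast
    show "G ` (?p \<times> ?e) \<subseteq> block_stabilizer n P"
    proof (rule image_subsetI)
      fix x assume "x \<in> ?p \<times> ?e"
      then obtain p e where "p \<in> ?p" "e \<in> ?e" "x = (p, e)" by (rule SigmaE)
      then show "G x \<in> block_stabilizer n P" using GS by (simp only:)
    qed
    show "H ` block_stabilizer n P \<subseteq> ?p \<times> ?e" using H(1) by (rule image_subsetI)
  qed
  then have "card (block_stabilizer n P) = card (?p \<times> ?e)" by (rule bij_betw_same_card[symmetric])
  then show ?thesis by (simp only: card_cartesian_product)
qed

section \<open>Subalgebras and their coatoms\<close>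

lemma finite_MR_subalgebra: "MR_subalgebra n A \<Longrightarrow> finite A"
  by (rule finite_subset[OF _ finite_cube[of n]]) (simp add: MR_subalgebra_def)

lemma MR_subalgebra_lits:
  assumes A: "MR_subalgebra n A" and L: "L \<in> lits s ` A" and M: "M \<in> lits s ` A"
  shows "L \<in> consistent n" "L \<inter> M \<in> lits s ` A" "neg_lit ` L \<in> lits s ` A"
    "L \<union> neg_lit ` (M - L) \<in> lits s ` A"
proof -
  obtain x y where xy: "x \<in> A" "L = lits s x" "y \<in> A" "M = lits s y" using L M by blast
  have AS: "A \<subseteq> carrier (cube n)" and top: "cube_top \<in> A" using A by (simp_all add: MR_subalgebra_def)
  then have c: "x \<in> carrier (cube n)" "y \<in> carrier (cube n)" using xy by auto
  then show "L \<in> consistent n" by (simp add: xy)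
  have "x \<squnion>\<^bsub>cube n\<^esub> y \<in> A" using A xy unfolding MR_subalgebra_def by blast
  then show "L \<inter> M \<in> lits s ` A" using lits_join[OF c, of s] xy by (metis imageI)
  have "caret n x y \<in> A" using A xy unfolding MR_subalgebra_def by blast
  then show "L \<union> neg_lit ` (M - L) \<in> lits s ` A" using lits_caret[OF c, of s] xy by (metis imageI)
  have "x \<sqsubseteq>\<^bsub>cube n\<^esub> cube_top" by (simp add: cube_le_iff_lits[of n _ _ s])
  then have "reflect cube_top x \<in> A" using A top xy unfolding MR_subalgebra_def by blast
  moreover have "lits s (reflect cube_top x) = neg_lit ` L" by (simp add: lits_reflect xy)
  ultimately show "neg_lit ` L \<in> lits s ` A" by (metis imageI)
qed

text \<open>The caret flips the part \<open>M - L\<close>; negating the result flips it back while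
  sending \<open>L\<close> to its negative, which the consistent set \<open>M\<close> does not meet.
  Intersecting with \<open>M\<close> isolates the difference.\<close>

lemma MR_subalgebra_lits_Diff:
  assumes A: "MR_subalgebra n A" and L: "L \<in> lits s ` A" and M: "M \<in> lits s ` A" and "L \<subseteq> M"
  shows "M - L \<in> lits s ` A"
proof -
  note cl = MR_subalgebra_lits[OF A]
  have "neg_lit ` (L \<union> neg_lit ` (M - L)) \<inter> M \<in> lits s ` A"
    by (rule cl(2)[OF cl(3)[OF cl(4)[OF L M] M] M])
  moreover have "neg_lit ` (L \<union> neg_lit ` (M - L)) \<inter> M = M - L"
  proof -
    have "neg_lit ` L \<inter> M = {}"
      using consistentD(2)[OF cl(1)[OF M M]] \<open>L \<subseteq> M\<close> by auto
    moreover have "neg_lit ` neg_lit ` (M - L) = M - L" by (simp add: image_image)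
    ultimately show ?thesis unfolding image_Un by blast
  qed
  ultimately show ?thesis by (simp only:)
qed

text \<open>Apply the caret to \<open>L\<close> and the negative of \<open>M\<close>. By consistency
  that negative is disjoint from \<open>L\<close>, so all of it is flipped back to \<open>M\<close>
  and added.\<close>

lemma MR_subalgebra_lits_Un:
  assumes A: "MR_subalgebra n A" and L: "L \<in> lits s ` A" and M: "M \<in> lits s ` A"
    and c: "L \<union> M \<in> consistent n"
  shows "L \<union> M \<in> lits s ` A"
proof -
  note cl = MR_subalgebra_lits[OF A]
  have "L \<union> neg_lit ` (neg_lit ` M - L) \<in> lits s ` A" by (rule cl(4)[OF L cl(3)[OF M M]])
  moreover have "neg_lit ` (neg_lit ` M - L) = M"
  proof -
    have "neg_lit ` M \<inter> L = {}" using consistentD(2)[OF c] by auto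
    then have "neg_lit ` M - L = neg_lit ` M" by blast
    then show ?thesis by (simp add: image_image)
  qed
  ultimately show ?thesis by (simp only:)
qed

lemma lits_coatoms_iff:
  "c \<in> lits s ` coatoms n A \<longleftrightarrow>
    c \<in> lits s ` A \<and> c \<noteq> {} \<and> (\<forall>d\<in>lits s ` A. d \<noteq> {} \<and> d \<subseteq> c \<longrightarrow> d = c)"
proof -
  have ne: "lits s x = {} \<longleftrightarrow> x = cube_top" for x by (metis lits_cube_top lits_inject)
  have "a \<in> coatoms n A \<longleftrightarrow>
      a \<in> A \<and> lits s a \<noteq> {} \<and> (\<forall>b\<in>A. lits s b \<noteq> {} \<and> lits s b \<subseteq> lits s a \<longrightarrow> b = a)" for a
    by (auto simp: coatoms_def cube_le_iff_lits[of n _ _ s] ne)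
  then show ?thesis by (auto simp: image_iff)
qed

text \<open>Take a minimal member \<open>c\<close> between \<open>l\<close> and \<open>L\<close>. A
  nonempty proper submember \<open>d\<close> avoiding \<open>l\<close> would leave the smaller
  candidate \<open>c - d\<close>, so \<open>c\<close> is minimal among all nonempty members.\<close>

lemma coatom_containing:
  assumes A: "MR_subalgebra n A" and L: "L \<in> lits s ` A" "l \<in> L"
  shows "\<exists>c\<in>lits s ` coatoms n A. l \<in> c \<and> c \<subseteq> L"
proof -
  let ?S = "{M \<in> lits s ` A. l \<in> M \<and> M \<subseteq> L}"
  have "finite (lits s ` A)" using finite_MR_subalgebra[OF A] by simp
  then have "finite ?S" by simp
  moreover have "?S \<noteq> {}" using L by blast
  ultimately have "\<exists>c\<in>?S. \<forall>M\<in>?S. M \<subseteq> c \<longrightarrow> c = M" by (rule finite_has_minimal)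
  then obtain c where c: "c \<in> ?S" and min: "\<forall>M\<in>?S. M \<subseteq> c \<longrightarrow> c = M" by (rule bexE)
  have "d = c" if d: "d \<in> lits s ` A" "d \<noteq> {}" "d \<subseteq> c" for d
  proof (cases "l \<in> d")
    case True
    then have "d \<in> ?S" using c d by blast
    then show ?thesis using min[rule_format, of d] d(3) by simp
  next
    case False
    have "c - d \<in> lits s ` A" using MR_subalgebra_lits_Diff[OF A d(1) _ d(3)] c by blast
    then have "c - d \<in> ?S" using c False by blast
    then have "c = c - d" by (rule min[rule_format]) blast
    then show ?thesis using d by blast
  qed
  then have "c \<in> lits s ` coatoms n A" using c unfolding lits_coatoms_iff by blast
  then show ?thesis using c by blast
qed

lemma Union_coatoms_in_subalgebra:
  assumes A: "MR_subalgebra n A" and D: "D \<subseteq> lits s ` coatoms n A" "\<Union>D \<in> consistent n"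
  shows "\<Union>D \<in> lits s ` A"
proof -
  have sub: "lits s ` coatoms n A \<subseteq> lits s ` A" by (auto simp: coatoms_def)
  have "finite (lits s ` A)" using finite_MR_subalgebra[OF A] by simp
  then have "finite D" using D sub by (meson finite_subset)
  then show ?thesis using D
  proof (induction D rule: finite_induct)
    case empty
    have "cube_top \<in> A" using A by (simp add: MR_subalgebra_def)
    then show ?case by (metis Union_empty imageI lits_cube_top)
  next
    case (insert c D)
    have "\<Union>D \<in> consistent n" using insert.prems(2) by (rule consistent_subset) auto
    then have "\<Union>D \<in> lits s ` A" using insert by simp
    moreover have "c \<in> lits s ` A" using insert.prems(1) sub by (meson insert_subset subsetD)
    ultimately have "c \<union> \<Union>D \<in> lits s ` A"
      using insert.prems(2) by (intro MR_subalgebra_lits_Un[OF A]) simp_all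
    then show ?case by simp
  qed
qed

section \<open>Stabilizing a subalgebra by permuting its coatoms\<close>

text \<open>If coatoms go to coatoms, then each member of \<open>A\<close>, being a union of
  coatoms, goes to a consistent union of coatoms and stays in \<open>A\<close>; finiteness turns
  this inclusion into equality.\<close>

lemma induced_auto_stabilizes_iff:
  assumes A: "MR_subalgebra n A" and g: "g \<in> signed_perms n"
  shows "induced_auto n s g ` A = A \<longleftrightarrow>
    (\<forall>c\<in>lits s ` coatoms n A. g ` c \<in> lits s ` coatoms n A)"
proof
  let ?f = "induced_auto n s g"
  have AS: "A \<subseteq> carrier (cube n)" using A by (simp add: MR_subalgebra_def)
  have lf: "lits s (?f x) = g ` lits s x" if "x \<in> A" for x
    using that AS by (intro lits_induced_auto) auto
  have inj: "inj_on g (literals n)" using g by (simp add: signed_perms_def)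
  have lU: "lits s x \<subseteq> literals n" if "x \<in> A" for x
    using that AS by (intro consistentD(1)) auto
  {
    assume st: "?f ` A = A"
    show "\<forall>c\<in>lits s ` coatoms n A. g ` c \<in> lits s ` coatoms n A"
    proof
      fix c assume "c \<in> lits s ` coatoms n A"
      then have c: "c \<in> lits s ` A" "c \<noteq> {}" "\<And>d. d \<in> lits s ` A \<Longrightarrow> d \<noteq> {} \<Longrightarrow> d \<subseteq> c \<Longrightarrow> d = c"
        unfolding lits_coatoms_iff by blast+
      then obtain a where a: "a \<in> A" "c = lits s a" by blast
      have "?f a \<in> A" using st a by blast
      then have "g ` c \<in> lits s ` A" using lf[OF a(1)] a(2) by (metis imageI)
      moreover have "d = g ` c" if d: "d \<in> lits s ` A" "d \<noteq> {}" "d \<subseteq> g ` c" for d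
      proof -
        \<comment> \<open>Since \<open>A\<close> is its own image, \<open>d\<close> can be pulled
          back to a member of \<open>A\<close> inside \<open>c\<close>, where minimality of
          \<open>c\<close> applies.\<close>
        have "d \<in> lits s ` ?f ` A" using d(1) unfolding st .
        then obtain x where x: "x \<in> A" "d = lits s (?f x)" unfolding image_image by (rule imageE)
        then have dx: "d = g ` lits s x" using lf by simp
        have "lits s x \<subseteq> c"
        proof
          fix l assume l: "l \<in> lits s x"
          then have "g l \<in> g ` c" "l \<in> literals n" using dx d(3) lU[OF x(1)] by auto
          then show "l \<in> c" using inj_on_image_mem_iff[OF inj] lU[OF a(1)] a(2) by blast
        qed
        moreover have "lits s x \<noteq> {}" using dx d(2) by auto
        ultimately have "lits s x = c" using c(3) x(1) by blast
        then show ?thesis using dx by simp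
      qed
      ultimately show "g ` c \<in> lits s ` coatoms n A"
        using c(2) unfolding lits_coatoms_iff by blast
    qed
  next
    assume st: "\<forall>c\<in>lits s ` coatoms n A. g ` c \<in> lits s ` coatoms n A"
    have "?f x \<in> A" if x: "x \<in> A" for x
    proof -
      let ?D = "{c \<in> lits s ` coatoms n A. c \<subseteq> lits s x}"
      have D: "\<Union>?D = lits s x"
        using coatom_containing[OF A, of "lits s x" s] x by blast
      have "g ` lits s x \<in> consistent n"
        using x AS by (intro signed_perm_image_consistent[OF g]) auto
      moreover have "g ` lits s x = \<Union>((`) g ` ?D)"
        by (subst D[symmetric]) blast
      moreover have "(`) g ` ?D \<subseteq> lits s ` coatoms n A" using st by blast
      ultimately have "g ` lits s x \<in> lits s ` A"
        using Union_coatoms_in_subalgebra[OF A, of "(`) g ` ?D" s] by (simp only:)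
      then have "lits s (?f x) \<in> lits s ` A" using lf[OF x] by simp
      then show ?thesis by auto
    qed
    moreover have "inj_on ?f (carrier (cube n))"
      using induced_auto_in_cube_auto[OF g, of s] by (simp add: cube_auto_def Bij_def bij_betw_def)
    then have "inj_on ?f A" using AS by (rule inj_on_subset)
    moreover have "finite A" using A by (rule finite_MR_subalgebra)
    ultimately show "?f ` A = A" by (intro endo_inj_surj) auto
  }
qed

lemma order_Stab_eq_card_block_stabilizer:
  assumes A: "MR_subalgebra n A"
    and C: "lits s ` coatoms n A = (\<lambda>(B, b). B \<times> {b}) ` (P \<times> UNIV)"
  shows "order (Stab n A) = card (block_stabilizer n P)"
proof -
  have "block_stabilizer n P = {g \<in> signed_perms n. induced_auto n s g ` A = A}"
    unfolding block_stabilizer_def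
  proof (rule Collect_cong)
    fix g
    have "c \<in> lits s ` coatoms n A \<longleftrightarrow> (\<exists>B\<in>P. \<exists>b. c = B \<times> {b})" for c
      unfolding C by auto
    moreover have "(\<forall>c\<in>lits s ` coatoms n A. g ` c \<in> lits s ` coatoms n A) \<longleftrightarrow>
        (\<forall>B\<in>P. \<forall>b. g ` (B \<times> {b}) \<in> lits s ` coatoms n A)"
      unfolding C by auto
    ultimately have "(\<forall>c\<in>lits s ` coatoms n A. g ` c \<in> lits s ` coatoms n A) \<longleftrightarrow>
        (\<forall>B\<in>P. \<forall>b. \<exists>B'\<in>P. \<exists>b'. g ` (B \<times> {b}) = B' \<times> {b'})" by simp
    then show "(g \<in> signed_perms n \<and> (\<forall>B\<in>P. \<forall>b. \<exists>B'\<in>P. \<exists>b'. g ` (B \<times> {b}) = B' \<times> {b'})) =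
        (g \<in> signed_perms n \<and> induced_auto n s g ` A = A)"
      using induced_auto_stabilizes_iff[OF A, of g s] by (simp only: cong: conj_cong)
  qed
  then have "induced_auto n s ` block_stabilizer n P = {f \<in> cube_auto n. f ` A = A}"
    using bij_betw_induced_auto[of n s] by (auto simp: bij_betw_def)
  moreover have "inj_on (induced_auto n s) (block_stabilizer n P)"
    using bij_betw_induced_auto[of n s]
    by (auto simp: bij_betw_def block_stabilizer_def intro: inj_on_subset)
  ultimately have "card {f \<in> cube_auto n. f ` A = A} = card (block_stabilizer n P)"
    by (metis card_image)
  then show ?thesis by (simp add: order_def Stab_def Aut_def)
qed

section \<open>Orienting the coatoms and relating blocks to the type\<close>

text \<open>The blocks are the supports of coatoms. Two coatoms whose supports meet agree in sign at
  a common coordinate after swapping one of them if necessary, so they are equal or opposite; hence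
  distinct supports are disjoint.\<close>

lemma ex_coatom_orientation:
  assumes A: "MR_subalgebra n A"
  obtains s P where "\<Union>P \<subseteq> {1..n}" "disjoint P" "{} \<notin> P"
    "lits s ` coatoms n A = (\<lambda>(B, b). B \<times> {b}) ` (P \<times> UNIV)"
proof -
  define P where "P = (\<lambda>a. fst a \<union> snd a) ` coatoms n A"
  obtain f where f: "f B \<in> coatoms n A" "fst (f B) \<union> snd (f B) = B" if "B \<in> P" for B
  proof
    fix B assume "B \<in> P"
    then show "inv_into (coatoms n A) (\<lambda>a. fst a \<union> snd a) B \<in> coatoms n A"
      "fst (inv_into (coatoms n A) (\<lambda>a. fst a \<union> snd a) B) \<union>
       snd (inv_into (coatoms n A) (\<lambda>a. fst a \<union> snd a) B) = B"
      unfolding P_def by (rule inv_into_into, rule f_inv_into_f)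
  qed
  have cc: "X1 \<subseteq> {1..n} \<and> X2 \<subseteq> {1..n} \<and> X1 \<inter> X2 = {} \<and> (X1 \<noteq> {} \<or> X2 \<noteq> {})"
    if "(X1, X2) \<in> coatoms n A" for X1 X2
    using that by (rule coatoms_carrier[OF A])
  have meet: "(Y1, Y2) = (X1, X2) \<or> (Y1, Y2) = (X2, X1)"
    if X: "(X1, X2) \<in> coatoms n A" and Y: "(Y1, Y2) \<in> coatoms n A" and j: "j \<in> X1 \<union> X2" "j \<in> Y1 \<union> Y2"
    for X1 X2 Y1 Y2 j
    using coatoms_share[OF A X Y, of j] coatoms_share[OF A swap_coatoms[OF A X] Y, of j] j by blast
  have dis: "B = B'" if "B \<in> P" "B' \<in> P" "j \<in> B" "j \<in> B'" for B B' j
  proof -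
    obtain X1 X2 Y1 Y2 where X: "(X1, X2) \<in> coatoms n A" "B = X1 \<union> X2"
      and Y: "(Y1, Y2) \<in> coatoms n A" "B' = Y1 \<union> Y2"
      using \<open>B \<in> P\<close> \<open>B' \<in> P\<close> unfolding P_def by fastforce
    show ?thesis using meet[OF X(1) Y(1), of j] that(3,4) X Y by blast
  qed
  \<comment> \<open>The chosen coatom \<open>f B\<close> of each block gets only positive literals
    under this orientation: \<open>s\<close> is true on its first component and false on its second.
    Coordinates outside the blocks get the default \<open>False\<close>.\<close>
  define s where "s i \<longleftrightarrow> (\<exists>B\<in>P. i \<in> fst (f B))" for i
  have lf: "lits s (f B) = B \<times> {True}" and lsf: "lits s (prod.swap (f B)) = B \<times> {False}"
    if B: "B \<in> P" for B
  proof -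
    obtain X1 X2 where X: "f B = (X1, X2)" by (cases "f B")
    have B12: "B = X1 \<union> X2" "X1 \<inter> X2 = {}" using f[OF B] cc[of X1 X2] X by simp_all
    have s1: "s i" if "i \<in> X1" for i unfolding s_def using that X by (intro bexI[OF _ B]) simp
    have s2: "\<not> s i" if i: "i \<in> X2" for i
    proof
      assume "s i"
      then obtain B' where B': "B' \<in> P" "i \<in> fst (f B')" by (auto simp: s_def)
      then have "i \<in> B'" using f(2) by blast
      then have "B' = B" using dis[OF B'(1) B] i B12 by blast
      then show False using B' X B12 i by auto
    qed
    show "lits s (f B) = B \<times> {True}" "lits s (prod.swap (f B)) = B \<times> {False}"
      unfolding X using s1 s2 by (auto simp: B12 lits_iff split: if_splits)
  qed
  have swapf: "prod.swap (f B) \<in> coatoms n A" if "B \<in> P" for B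
    using swap_coatoms[OF A, of "fst (f B)" "snd (f B)"] f(1)[OF that] by (simp add: prod.swap_def)
  have eq: "lits s ` coatoms n A = (\<lambda>(B, b). B \<times> {b}) ` (P \<times> UNIV)"
  proof (intro equalityI subsetI)
    fix c assume "c \<in> lits s ` coatoms n A"
    then obtain X1 X2 where X: "(X1, X2) \<in> coatoms n A" "c = lits s (X1, X2)" by auto
    let ?B = "X1 \<union> X2"
    have B: "?B \<in> P" using X(1) unfolding P_def by force
    obtain j where j: "j \<in> ?B" using cc[OF X(1)] by blast
    have "(X1, X2) = f ?B \<or> (X1, X2) = prod.swap (f ?B)"
      using meet[of "fst (f ?B)" "snd (f ?B)" X1 X2 j] f[OF B] X(1) j by (simp add: prod.swap_def)
    then have "c = ?B \<times> {True} \<or> c = ?B \<times> {False}" using X(2) lf[OF B] lsf[OF B] by metis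
    then show "c \<in> (\<lambda>(B, b). B \<times> {b}) ` (P \<times> UNIV)" using B by blast
  next
    fix c assume "c \<in> (\<lambda>(B, b). B \<times> {b}) ` (P \<times> (UNIV :: bool set))"
    then obtain B b where B: "B \<in> P" "c = B \<times> {b}" by blast
    then have "c = lits s (f B) \<or> c = lits s (prod.swap (f B))" using lf lsf by (cases b) auto
    then show "c \<in> lits s ` coatoms n A" using f(1)[OF B(1)] swapf[OF B(1)] by blast
  qed
  have "\<Union>P \<subseteq> {1..n}" "{} \<notin> P" using cc by (fastforce simp: P_def)+
  moreover have "disjoint P" using dis by (auto intro!: disjointI)
  ultimately show ?thesis using that eq by blast
qed

text \<open>A block of size \<open>i\<close> carries exactly two coatoms, one per sign, which
  matches the factor 2 in \<open>has_type\<close>. Blocks are nonempty, so B \<times> {b} determines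
  \<open>B\<close> and \<open>b\<close>.\<close>

lemma card_blocks_of_type:
  assumes A: "MR_subalgebra n A" and t: "has_type n A t" and i: "i \<in> {1..n}"
    and P: "{} \<notin> P" and C: "lits s ` coatoms n A = (\<lambda>(B, b). B \<times> {b}) ` (P \<times> UNIV)"
  shows "card {B \<in> P. card B = i} = t i"
proof -
  let ?T = "{a \<in> coatoms n A. card (coatoms_above n a) = i}"
  let ?E = "\<lambda>(B :: nat set, b :: bool). B \<times> {b}"
  have "card (coatoms_above n a) = card (fst ` lits s a)" if a: "a \<in> coatoms n A" for a
  proof -
    obtain X1 X2 where [simp]: "a = (X1, X2)" by (cases a)
    have "fst ` lits s a = X1 \<union> X2"
    proof (intro equalityI subsetI)
      fix j assume j: "j \<in> X1 \<union> X2"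
      then have "(j, j \<in> X1 \<longleftrightarrow> s j) \<in> lits s a" by (auto simp: lits_iff)
      then show "j \<in> fst ` lits s a" by force
    qed (auto simp: lits_iff split: if_splits)
    moreover have "(X1, X2) \<in> carrier (cube n)" using coatoms_carrier[OF A, of X1 X2] a by simp
    ultimately show ?thesis by (simp add: card_coatoms_above del: cube_carrier)
  qed
  then have "lits s ` ?T = {c \<in> lits s ` coatoms n A. card (fst ` c) = i}" by auto
  also have "\<dots> = ?E ` ({B \<in> P. card B = i} \<times> UNIV)" unfolding C by auto
  finally have "card (lits s ` ?T) = card (?E ` ({B \<in> P. card B = i} \<times> UNIV))" by simp
  moreover have "inj_on (lits s) ?T" by (simp add: inj_on_def)
  moreover have "inj_on ?E ({B \<in> P. card B = i} \<times> UNIV)"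
    using P by (auto simp: inj_on_def times_eq_iff)
  ultimately have "card ?T = card ({B \<in> P. card B = i} \<times> (UNIV :: bool set))"
    by (simp add: card_image)
  moreover have "2 * t i = card ?T" using t i unfolding has_type_def by blast
  ultimately show ?thesis by (simp add: card_cartesian_product)
qed

theorem mainTheorem1:
  fixes n r k :: nat
    and A :: "(nat set \<times> nat set) set"
    and t :: "nat \<Rightarrow> nat"
  assumes "n \<ge> 1"
    and "MR_subalgebra n A"
    and "has_type n A t"
    and "r = (\<Sum>i=1..n. i * t i)"
    and "k = (\<Sum>i=1..n. t i)"
  shows "order (Stab n A) =
    2 ^ (n + k - r) * fact (n - r) * (\<Prod>i=1..n. fact i ^ t i * fact (t i))"
proof -
  obtain s P where P: "\<Union>P \<subseteq> {1..n}" "disjoint P" "{} \<notin> P"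
    and C: "lits s ` coatoms n A = (\<lambda>(B, b). B \<times> {b}) ` (P \<times> UNIV)"
    by (rule ex_coatom_orientation[OF assms(2)])
  have t: "card {B \<in> P. card B = i} = t i" if "i \<in> {1..n}" for i
    using card_blocks_of_type[OF assms(2,3) that P(3) C] .
  have finP: "finite P" using P(1) by (meson finite_UnionD finite_subset finite_atLeastAtMost)
  have sub: "B \<subseteq> {1..n}" if "B \<in> P" for B using that P(1) by blast
  then have finB: "finite B" if "B \<in> P" for B using that by (meson finite_subset finite_atLeastAtMost)
  \<comment> \<open>Nonempty blocks have size at least 1, so sums and products over the blocks can
    be grouped by sizes from 1 to n.\<close>
  have I: "card ` P \<subseteq> {1..n}"
  proof
    fix m assume "m \<in> card ` P"
    then obtain B where B: "B \<in> P" "m = card B" by blast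
    have "B \<noteq> {}" using B P(3) by blast
    then show "m \<in> {1..n}"
      using B finB[OF B(1)] card_mono[OF _ sub[OF B(1)]] by (simp add: Suc_le_eq card_gt_0_iff)
  qed
  have k: "card P = k"
    using sum.group[OF finP _ I, of "\<lambda>_. 1 :: nat"] t assms(5) by simp
  have "card (\<Union>P) = (\<Sum>B\<in>P. card B)"
    using P(2) finB by (intro card_Union_disjoint) (auto simp: disjoint_def pairwise_def disjnt_def)
  also have "\<dots> = (\<Sum>i=1..n. \<Sum>B\<in>{B \<in> P. card B = i}. card B)"
    by (rule sum.group[OF finP _ I, symmetric]) simp
  also have "\<dots> = (\<Sum>i=1..n. i * t i)"
    using t by (intro sum.cong refl) simp
  finally have "card (\<Union>P) = r" using assms(4) by simp
  then have r: "card ({1..n} - \<Union>P) = n - r" "r \<le> n"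
    using P(1) card_mono[OF _ P(1)] by (simp_all add: card_Diff_subset finite_subset[OF P(1)])
  have "(\<Prod>B\<in>P. fact (card B)) = (\<Prod>i=1..n. \<Prod>B\<in>{B \<in> P. card B = i}. fact (card B) :: nat)"
    by (rule prod.group[OF finP _ I, symmetric]) simp
  also have "\<dots> = (\<Prod>i=1..n. fact i ^ t i)"
    using t by (intro prod.cong refl) simp
  finally have f: "(\<Prod>B\<in>P. fact (card B)) = (\<Prod>i=1..n. fact i ^ t i :: nat)" .
  have perms: "card {p \<in> {1..n} \<rightarrow>\<^sub>E {1..n}. inj_on p {1..n} \<and> (\<forall>B\<in>P. p ` B \<in> P)} =
      (\<Prod>i=1..n. fact (t i)) * ((\<Prod>i=1..n. fact i ^ t i) * fact (n - r))"
    using card_block_permutations[OF _ P _ I] t unfolding f r by simp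
  have signs: "card {e \<in> {1..n} \<rightarrow>\<^sub>E (UNIV :: bool set). \<forall>B\<in>P. \<forall>x\<in>B. \<forall>y\<in>B. e x = e y} = 2 ^ (k + (n - r))"
    using card_PiE_constant_on_blocks[OF _ P, of "UNIV :: bool set"] unfolding k r by simp
  have "order (Stab n A) = 2 ^ (k + (n - r)) * fact (n - r) * ((\<Prod>i=1..n. fact i ^ t i) * (\<Prod>i=1..n. fact (t i)))"
    unfolding order_Stab_eq_card_block_stabilizer[OF assms(2) C] card_block_stabilizer[OF P(1,3)] perms signs
    by (simp only: ac_simps)
  \<comment> \<open>The bound r \<le> n keeps the subtraction on natural numbers from
    truncating.\<close>
  moreover have "k + (n - r) = n + k - r" using r(2) by simp
  ultimately show ?thesis by (simp only: prod.distrib)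
qed

end
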